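(* Let $\mathcal Z$ be a diffusion in $\mathbb R^1$ that is regular and without traps (i.e. $P^x(T_y<\infty)>0$ for all $x,y\in\mathbb R^1$, where $T_y$ is the first hitting time of $y$), is symmetric with respect to a $\sigma$-finite measure $m$ (the speed measure) that is absolutely continuous with respect to Lebesgue measure, and has generator of the form $$\frac12a^2(x)\frac{d^2}{dx^2}+c(x)\frac{d}{dx},$$ where $a^2,c\in C(\mathbb R^1)$ and $a(x)\neq 0$ for all $x\in\mathbb R^1$. Let $\beta>0$ and let $Z$ be $\mathcal Z$ killed at the end of an independent exponential time with mean $1/\beta$. The potential density of $Z$ with respect to $m$ is $$\widetilde u^\beta(x,y)=\begin{cases}p_\beta(x)q_\beta(y),& x\le y,\\ q_\beta(x)p_\beta(y),& y\le x,\end{cases}$$ where $p_\beta,q_\beta\in C^2(\mathbb R^1)$ are positive, $p_\beta$ is strictly increasing and $q_\beta$ is strictly decreasing. Let $$\widetilde v^\beta(x,y)=\widetilde u^\beta(x,y)-\frac{\widetilde u^\beta(x,0)\,\widetilde u^\beta(0,y)}{\widetilde u^\beta(0,0)},\qquad x,y\ge 0 .$$ Let $T=(0,\infty)$, let $\mu$ be a finite positive measure on $T$, and set $$f_{\widetilde v^\beta,\mu}(y)=\int_T\widetilde v^\beta(x,y)\,d\mu(x),\qquad v(x,y)=\widetilde v^\beta(x,y)+f_{\widetilde v^\beta,\mu}(y),\qquad x,y\ge0 .$$ Let $\alpha>0$ and let $\{X_\alpha(t),\ t\in[0,1]\}$ be an $\alpha$-permanental process with kernel $\{v(x,y),\ x,y\in[0,1]\}$.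 Then $X_\alpha(t)$ is continuous on $[0,\delta]$ for some $\delta>0$, and $$\limsup_{t\downarrow 0}\frac{X_\alpha(t)}{\rho_\beta(0)\,t\log\log 1/t}\le 1+\int_0^\infty\frac{q_\beta(y)}{q_\beta(0)}\,d\mu(y)\qquad\text{a.s.},$$ where $\rho_\beta(0)=p_\beta'(0)q_\beta(0)-q_\beta'(0)p_\beta(0)$.
   Context: For $\alpha>0$, an $\alpha$-permanental process with kernel $K=\{K(s,t),\ s,t\in[0,1]\}$ is a stochastic process $\{X_\alpha(t),\ t\in[0,1]\}$ with nonnegative values such that for all $n$, all $t_1,\dots,t_n\in[0,1]$ and all $s_1,\dots,s_n>0$, $$E\left(e^{-\sum_{i=1}^n s_iX_\alpha(t_i)}\right)=\frac{1}{\det\left(I+\mathcal K\,\Sigma\right)^{\alpha}},$$ where $\mathcal K=\{K(t_i,t_j)\}_{i,j=1}^n$ and $\Sigma$ is the diagonal matrix with entries $s_1,\dots,s_n$. Sample path statements are, as usual, understood for a suitable (separable, respectively continuous) version of the process. $\widetilde v^\beta$, restricted to $T\times T$, is the potential density with respect to $m$ of the process obtained by starting $Z$ in $T$ and killing it the first time it hits $0$. It is known that an $\alpha$-permanental process with kernel $v$ on $[0,1]$ exists for every $\alpha>0$. *)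

theory Defs
  imports "HOL-Probability.Probability" "Jordan_Normal_Form.Determinant"
begin

section \<open>Diffusions on the real line\<close>

text \<open>
  A process with state space \<open>\<real>\<close> is modelled with values in \<open>real option\<close>, where \<open>None\<close> is the
  cemetery point. Time runs through the reals \<open>t \<ge> 0\<close>; values at negative times are irrelevant.
  Functions \<open>f\<close> on \<open>\<real>\<close> are extended by \<open>0\<close> to the cemetery, i.e. \<open>f (X t \<omega>)\<close> is
  \<open>case_option 0 f (X t \<omega>)\<close>.
\<close>

definition state_space :: "real option measure" where
  "state_space = sigma UNIV {Some ` B |B. B \<in> sets borel}"

definition nat_filtration :: "'w measure \<Rightarrow> (real \<Rightarrow> 'w \<Rightarrow> real option) \<Rightarrow> ennreal \<Rightarrow> 'w measure" where
  "nat_filtration M X t = sigma (space M)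
     (\<Union>s\<in>{s. 0 \<le> s \<and> ennreal s \<le> t}. {X s -` A \<inter> space M |A. A \<in> sets state_space})"

text \<open>
  The right limit \<open>t+\<close> of the natural filtration. The disjunct \<open>u = \<infinity>\<close> only serves to make the
  intersection at \<open>t = \<infinity>\<close> equal to the \<open>\<sigma>\<close>-algebra generated by the whole process.
\<close>

definition right_filtration :: "'w measure \<Rightarrow> (real \<Rightarrow> 'w \<Rightarrow> real option) \<Rightarrow> ennreal \<Rightarrow> 'w measure" where
  "right_filtration M X t =
     sigma (space M) (\<Inter>u\<in>{u. t < u \<or> u = \<infinity>}. sets (nat_filtration M X u))"

lemma filtration_right_filtration: "filtration (space M) (right_filtration M X)"
proof
  have sub: "(\<Inter>u\<in>{u. t < u \<or> u = \<infinity>}. sets (nat_filtration M X u)) \<subseteq> Pow (space M)" for t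
  proof -
    have "sets (nat_filtration M X \<infinity>) \<subseteq> Pow (space M)"
      using sets.space_closed[of "nat_filtration M X \<infinity>"]
      by (simp add: nat_filtration_def space_measure_of_conv)
    then show ?thesis by auto
  qed
  show "space (right_filtration M X i) = space M" for i
    by (simp add: right_filtration_def space_measure_of_conv)
  show "sets (right_filtration M X i) \<le> sets (right_filtration M X j)" if "i \<le> j" for i j
    unfolding right_filtration_def sets_measure_of[OF sub]
    using that by (intro sigma_sets_mono') fastforce
qed

text \<open>
  \<open>P x\<close> is the law of the process started in \<open>x\<close>. Paths are continuous in \<open>\<real>\<close> up to the lifetime
  \<open>\<zeta>\<close>, which may be infinite, and sit in the cemetery from \<open>\<zeta>\<close> on.
\<close>

locale diffusion =
  fixes M :: "'w measure" and P :: "real \<Rightarrow> 'w measure" and X :: "real \<Rightarrow> 'w \<Rightarrow> real option"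
  assumes prob_space_P: "\<And>x. prob_space (P x)"
    and sets_P: "\<And>x. sets (P x) = sets M"
    and measurable_X: "\<And>t. 0 \<le> t \<Longrightarrow> X t \<in> measurable M state_space"
    and measurable_kernel: "\<And>t B. 0 \<le> t \<Longrightarrow> B \<in> sets borel \<Longrightarrow>
      (\<lambda>x. emeasure (P x) {\<omega> \<in> space M. X t \<omega> \<in> Some ` B}) \<in> borel_measurable borel"
    and start: "\<And>x. AE \<omega> in P x. X 0 \<omega> = Some x"
    and continuous_paths: "\<And>\<omega>. \<omega> \<in> space M \<Longrightarrow>
      \<exists>\<zeta>::ennreal. (\<forall>t\<ge>0. X t \<omega> \<noteq> None \<longleftrightarrow> ennreal t < \<zeta>) \<and>
        continuous_on {t. 0 \<le> t \<and> ennreal t < \<zeta>} (\<lambda>t. the (X t \<omega>))"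
    and strong_markov: "\<And>x \<tau> A t B.
      stopping_time (right_filtration M X) \<tau> \<Longrightarrow>
      A \<in> sets (filtration.pre_sigma (space M) (right_filtration M X) \<tau>) \<Longrightarrow>
      0 \<le> t \<Longrightarrow> B \<in> sets borel \<Longrightarrow>
      emeasure (P x) {\<omega> \<in> A. \<tau> \<omega> < \<infinity> \<and> X (enn2real (\<tau> \<omega>) + t) \<omega> \<in> Some ` B} =
        (\<integral>\<^sup>+\<omega> \<in> {\<omega> \<in> A. \<tau> \<omega> < \<infinity>}.
           case_option 0 (\<lambda>y. emeasure (P y) {\<omega>' \<in> space M. X t \<omega>' \<in> Some ` B})
             (X (enn2real (\<tau> \<omega>)) \<omega>) \<partial>P x)"

definition hitting_time :: "(real \<Rightarrow> 'w \<Rightarrow> real option) \<Rightarrow> real \<Rightarrow> 'w \<Rightarrow> ennreal" where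
  "hitting_time X y \<omega> = Inf {ennreal t |t. 0 < t \<and> X t \<omega> = Some y}"

definition regular_without_traps ::
  "(real \<Rightarrow> 'w measure) \<Rightarrow> (real \<Rightarrow> 'w \<Rightarrow> real option) \<Rightarrow> bool" where
  "regular_without_traps P X \<longleftrightarrow>
     (\<forall>x y. measure (P x) {\<omega> \<in> space (P x). hitting_time X y \<omega> < \<infinity>} > 0)"

definition symmetric_wrt ::
  "(real \<Rightarrow> 'w measure) \<Rightarrow> (real \<Rightarrow> 'w \<Rightarrow> real option) \<Rightarrow> real measure \<Rightarrow> bool" where
  "symmetric_wrt P X m \<longleftrightarrow>
     (\<forall>t\<ge>0. \<forall>f\<in>borel_measurable borel. \<forall>g\<in>borel_measurable borel.
       (\<integral>\<^sup>+x. f x * (\<integral>\<^sup>+\<omega>. case_option 0 g (X t \<omega>) \<partial>P x) \<partial>m) =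
       (\<integral>\<^sup>+x. g x * (\<integral>\<^sup>+\<omega>. case_option 0 f (X t \<omega>) \<partial>P x) \<partial>m))"

definition C2 :: "(real \<Rightarrow> real) \<Rightarrow> bool" where
  "C2 f \<longleftrightarrow> f differentiable_on UNIV \<and> deriv f differentiable_on UNIV \<and>
     continuous_on UNIV (deriv (deriv f))"

text \<open>
  The generator is understood through its action on \<open>C\<^sup>2\<close> functions of compact support, with
  pointwise convergence of the difference quotients. This is implied by convergence in supremum norm.
\<close>

definition has_generator ::
  "(real \<Rightarrow> 'w measure) \<Rightarrow> (real \<Rightarrow> 'w \<Rightarrow> real option) \<Rightarrow> ((real \<Rightarrow> real) \<Rightarrow> real \<Rightarrow> real) \<Rightarrow> bool" where
  "has_generator P X G \<longleftrightarrow>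
     (\<forall>f. C2 f \<and> compact (closure {x. f x \<noteq> 0}) \<longrightarrow>
       (\<forall>x. ((\<lambda>t. ((\<integral>\<omega>. case_option 0 f (X t \<omega>) \<partial>P x) - f x) / t) \<longlongrightarrow> G f x) (at_right 0)))"

definition diffusion_operator ::
  "(real \<Rightarrow> real) \<Rightarrow> (real \<Rightarrow> real) \<Rightarrow> (real \<Rightarrow> real) \<Rightarrow> real \<Rightarrow> real" where
  "diffusion_operator a c f x = 1/2 * (a x)\<^sup>2 * deriv (deriv f) x + c x * deriv f x"

text \<open>
  Killing at an independent exponential time with mean \<open>1 / \<beta>\<close>: the killing time is the second
  coordinate of the product space.
\<close>

definition exp_killed_law :: "real \<Rightarrow> (real \<Rightarrow> 'w measure) \<Rightarrow> real \<Rightarrow> ('w \<times> real) measure" where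
  "exp_killed_law \<beta> P x = P x \<Otimes>\<^sub>M density lborel (exponential_density \<beta>)"

definition killed_process :: "(real \<Rightarrow> 'w \<Rightarrow> real option) \<Rightarrow> real \<Rightarrow> ('w \<times> real) \<Rightarrow> real option" where
  "killed_process X t = (\<lambda>(\<omega>, l). if t < l then X t \<omega> else None)"

definition potential_density ::
  "(real \<Rightarrow> 'w measure) \<Rightarrow> (real \<Rightarrow> 'w \<Rightarrow> real option) \<Rightarrow> real measure \<Rightarrow>
   (real \<Rightarrow> real \<Rightarrow> real) \<Rightarrow> bool" where
  "potential_density P X m u \<longleftrightarrow>
     (\<forall>x. \<forall>B\<in>sets borel.
       (\<integral>\<^sup>+\<omega>. (\<integral>\<^sup>+t\<in>{0..}. indicator (Some ` B) (X t \<omega>) \<partial>lborel) \<partial>P x) =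
       (\<integral>\<^sup>+y\<in>B. ennreal (u x y) \<partial>m))"

section \<open>Kernels\<close>

definition u_kernel :: "(real \<Rightarrow> real) \<Rightarrow> (real \<Rightarrow> real) \<Rightarrow> real \<Rightarrow> real \<Rightarrow> real" where
  "u_kernel p q x y = (if x \<le> y then p x * q y else q x * p y)"

definition v_kernel :: "(real \<Rightarrow> real) \<Rightarrow> (real \<Rightarrow> real) \<Rightarrow> real \<Rightarrow> real \<Rightarrow> real" where
  "v_kernel p q x y = u_kernel p q x y - u_kernel p q x 0 * u_kernel p q 0 y / u_kernel p q 0 0"

definition potential_fun :: "(real \<Rightarrow> real \<Rightarrow> real) \<Rightarrow> real measure \<Rightarrow> real \<Rightarrow> real" where
  "potential_fun w \<mu> y = (\<integral>x. w x y \<partial>\<mu>)"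

section \<open>Permanental processes\<close>

definition permanental_process ::
  "'b measure \<Rightarrow> real \<Rightarrow> (real \<Rightarrow> real \<Rightarrow> real) \<Rightarrow> real set \<Rightarrow> (real \<Rightarrow> 'b \<Rightarrow> real) \<Rightarrow> bool" where
  "permanental_process N \<alpha> K I Y \<longleftrightarrow>
     prob_space N \<and>
     (\<forall>t\<in>I. Y t \<in> borel_measurable N \<and> (\<forall>\<omega>\<in>space N. 0 \<le> Y t \<omega>)) \<and>
     (\<forall>n (t :: nat \<Rightarrow> real) (s :: nat \<Rightarrow> real). (\<forall>i<n. t i \<in> I \<and> 0 < s i) \<longrightarrow>
       (\<integral>\<omega>. exp (- (\<Sum>i<n. s i * Y (t i) \<omega>)) \<partial>N) =
       1 / Determinant.det (1\<^sub>m n + Matrix.mat n n (\<lambda>(i, j). K (t i) (t j)) * mat_diag n s) powr \<alpha>)"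

definition version_of :: "'b measure \<Rightarrow> real set \<Rightarrow> (real \<Rightarrow> 'b \<Rightarrow> real) \<Rightarrow> (real \<Rightarrow> 'b \<Rightarrow> real) \<Rightarrow> bool" where
  "version_of N I Y X \<longleftrightarrow> (\<forall>t\<in>I. AE \<omega> in N. Y t \<omega> = X t \<omega>)"

end

(*
  On [0, oo) the kernel of the killed process factorises as v(x, y) = phi(min x y) q(max x y) with
  phi = p - (p 0 / q 0) q, phi 0 = 0 and phi' 0 = rho / q 0, and the potential satisfies
  f y <= phi y * integral q dmu. Hence K(t, t) <= phi t (q 0 + integral q dmu), whose slope at 0 is
  rho (1 + integral q / q 0 dmu).

  Only the Laplace transforms of single values and of pairs of values are used. For s < t the
  two-point determinant K(s, s) K(t, t) - K(s, t) K(t, s) is O(t (t - s)), so continuing the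
  transform to negative arguments gives E exp (a |X t - X s|) = O(1) for a of order
  1 / sqrt (t (t - s)). Chaining over dyadic points with these exponential tails yields a continuous
  version and, on the intervals [theta^(k+1), theta^k] with theta close to 1, oscillations
  that are small compared with theta^k log k. The gamma tail P (X t > x) <= C exp (- b x), for every
  b < 1 / K(t, t), controls the values at the points theta^k.
*)
theory Submission
  imports Defs "HOL-Complex_Analysis.Cauchy_Integral_Formula" "HOL-Real_Asymp.Real_Asymp"
begin

section \<open>Exponential moments from the Laplace transform\<close>

text \<open>The potential depends on the second argument only, so the kernel is in general not
  symmetric, and the determinants are estimated directly instead of through Gaussian processes. This
  dependence also helps: the potential cancels in K t t - K s t and in K s s - K t s. The order t (t
  - s) of the determinant, in place of t - s, is what the iterated logarithm requires. The interval
  [theta^(k+1), theta^k] has length (1 - theta) theta^k, so increments on it have scale at most sqrt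
  (1 - theta) theta^k: the order of theta^k itself, with a factor that can be made as small as
  desired. A scale sqrt (t - s) would only give the order of sqrt (theta^k), which is far too large.
  The extra factor t comes from K 0 0 = 0. The tails are exponential and not Gaussian. Hence the
  chaining thresholds grow linearly in the level, and an oscillation bound with summable failure
  probabilities carries a full factor log k, the same as the values to be controlled; only the
  factor sqrt (1 - theta) makes it negligible.\<close>

lemma powser_coeff_unique:
  fixes a b :: "nat \<Rightarrow> real"
  assumes "0 < r"
    and "\<And>x. \<bar>x\<bar> < r \<Longrightarrow> (\<lambda>n. a n * x ^ n) sums f x"
    and "\<And>x. \<bar>x\<bar> < r \<Longrightarrow> (\<lambda>n. b n * x ^ n) sums f x"
  shows "a = b"
proof -
  have sums0: "(\<lambda>n. (a n - b n) * (x - 0) ^ n) sums 0" if "norm (x - 0) < r" for x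
    using sums_diff[OF assms(2,3)[of x]] that by (simp add: algebra_simps)
  have pos: "a n = b n" if "n > 0" for n
  proof (rule ccontr)
    assume "a n \<noteq> b n"
    then have "a n - b n \<noteq> 0" by simp
    \<comment> \<open>A nonzero coefficient of positive index would make 0 an isolated zero, but the
      difference series vanishes on a whole interval. The constant coefficients are compared at x =
      0.\<close>
    from powser_0_nonzero[of r 0 "\<lambda>n. a n - b n" "\<lambda>_. 0", OF \<open>0 < r\<close> sums0 _ this that]
    obtain s :: real where "0 < s" "\<And>z::real. z \<in> cball 0 s - {0} \<Longrightarrow> (0::real) \<noteq> 0"
      by auto
    from this(2)[of s] this(1) show False by simp
  qed
  moreover have "a 0 = b 0"
    using assms(2,3)[of 0] \<open>0 < r\<close> sums_unique2[of "\<lambda>n. a n * 0 ^ n" "f 0" "f 0"]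
    by (metis abs_zero mult_cancel_left1 power_0 powser_sums_zero_iff)
  ultimately show ?thesis by (metis ext gr0I)
qed

text \<open>
  The hypothesis determines the power series of \<open>r \<mapsto> \<integral> g exp (- (1 - r) W)\<close> near
  \<open>r = 0\<close>; its coefficients are nonnegative, so the series may be summed at \<open>r = 1 + b\<close>.
\<close>

lemma exp_moment_from_laplace_transform:
  fixes g W :: "'b \<Rightarrow> real"
  assumes g[measurable]: "integrable N g" and W[measurable]: "W \<in> borel_measurable N"
    and g0: "\<And>\<omega>. \<omega> \<in> space N \<Longrightarrow> 0 \<le> g \<omega>" and W0: "\<And>\<omega>. \<omega> \<in> space N \<Longrightarrow> 0 \<le> W \<omega>"
    and lap: "\<And>s. 0 < s \<Longrightarrow> (\<integral>\<omega>. g \<omega> * exp (- s * W \<omega>) \<partial>N) = (c + d * s) powr - \<alpha>"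
    and "0 < c" "0 \<le> d" "0 \<le> b" "b * d < c"
  shows "(\<integral>\<^sup>+\<omega>. ennreal (g \<omega> * exp (b * W \<omega>)) \<partial>N) = ennreal ((c - b * d) powr - \<alpha>)"
proof -
  have gm[measurable]: "g \<in> borel_measurable N" using g by auto
  \<comment> \<open>Expansion about s = 1 and not about s = 0: the factor
    \<open>exp (- W \<omega>)\<close> keeps every term below \<open>g\<close>, so the coefficients
    are finite before any moment of \<open>W\<close> is known to be.\<close>
  define h where "h n \<omega> = g \<omega> * exp (- W \<omega>) * (W \<omega> ^ n / fact n)" for n \<omega>
  have hm[measurable]: "h n \<in> borel_measurable N" for n unfolding h_def by measurable
  have h0: "0 \<le> h n \<omega>" if "\<omega> \<in> space N" for n \<omega>
    using that g0 W0 by (simp add: h_def)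
  have exp_sums: "(\<lambda>n. h n \<omega> * r ^ n) sums (g \<omega> * exp (- (1 - r) * W \<omega>))" for r \<omega>
  proof -
    have "(\<lambda>n. (g \<omega> * exp (- W \<omega>)) * ((r * W \<omega>) ^ n /\<^sub>R fact n)) sums
          ((g \<omega> * exp (- W \<omega>)) * exp (r * W \<omega>))"
      by (intro sums_mult exp_converges)
    moreover have "(g \<omega> * exp (- W \<omega>)) * exp (r * W \<omega>) = g \<omega> * exp (- (1 - r) * W \<omega>)"
      by (simp add: mult.assoc exp_add[symmetric] algebra_simps)
    moreover have "(g \<omega> * exp (- W \<omega>)) * ((r * W \<omega>) ^ n /\<^sub>R fact n) = h n \<omega> * r ^ n" for n
      by (simp add: h_def power_mult_distrib divide_inverse)
    ultimately show ?thesis by simp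
  qed
  have int1: "integrable N (\<lambda>\<omega>. g \<omega> * exp (- s * W \<omega>))" if "0 \<le> s" for s
  proof (rule Bochner_Integration.integrable_bound[OF g])
    show "AE \<omega> in N. norm (g \<omega> * exp (- s * W \<omega>)) \<le> norm (g \<omega>)"
      using W0 that by (intro AE_I2) (auto simp: abs_mult intro!: mult_left_le)
  qed auto
  have inth: "integrable N (h n)" for n
  proof (rule Bochner_Integration.integrable_bound[OF g])
    show "AE \<omega> in N. norm (h n \<omega>) \<le> norm (g \<omega>)"
    proof (rule AE_I2)
      fix \<omega> assume \<omega>: "\<omega> \<in> space N"
      have "W \<omega> ^ n / fact n \<le> exp (W \<omega>)"
        using W0[OF \<omega>]
          sums_le[OF _ sums_single[of n "\<lambda>n. W \<omega> ^ n / fact n"] exp_converges[of "W \<omega>"]]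
        by (auto simp: field_simps)
      then have "exp (- W \<omega>) * (W \<omega> ^ n / fact n) \<le> 1"
        by (simp add: exp_minus field_simps)
      from mult_left_mono[OF this g0[OF \<omega>]] show "norm (h n \<omega>) \<le> norm (g \<omega>)"
        using g0[OF \<omega>] h0[OF \<omega>, of n] by (simp add: h_def mult.assoc)
    qed
  qed auto
  define m where "m n = (\<integral>\<omega>. h n \<omega> \<partial>N)" for n
  have m0: "0 \<le> m n" for n unfolding m_def using h0 by (intro integral_nonneg_AE AE_I2)
  \<comment> \<open>By Tonelli this holds for every nonnegative r, whether or not the sides are
    finite. It supplies absolute convergence for r < 1 and is used again at r = 1 + b.\<close>
  have nn: "(\<integral>\<^sup>+\<omega>. ennreal (g \<omega> * exp (- (1 - r) * W \<omega>)) \<partial>N) = (\<Sum>n. ennreal (m n * r ^ n))"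
    if "0 \<le> r" for r
  proof -
    have "(\<integral>\<^sup>+\<omega>. ennreal (g \<omega> * exp (- (1 - r) * W \<omega>)) \<partial>N) =
        (\<integral>\<^sup>+\<omega>. (\<Sum>n. ennreal (h n \<omega> * r ^ n)) \<partial>N)"
      using h0 that
      by (intro nn_integral_cong) (subst suminf_ennreal_eq[OF _ exp_sums], auto)
    also have "\<dots> = (\<Sum>n. \<integral>\<^sup>+\<omega>. ennreal (h n \<omega> * r ^ n) \<partial>N)"
      by (intro nn_integral_suminf) auto
    also have "\<dots> = (\<Sum>n. ennreal (m n * r ^ n))"
      using h0 that inth unfolding m_def
      by (intro suminf_cong, subst nn_integral_eq_integral) auto
    finally show ?thesis .
  qed
  have m_sums: "(\<lambda>n. m n * r ^ n) sums (c + d * (1 - r)) powr - \<alpha>" if "\<bar>r\<bar> < 1" for r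
  proof -
    have "(\<lambda>n. m n * \<bar>r\<bar> ^ n) sums (\<integral>\<omega>. g \<omega> * exp (- (1 - \<bar>r\<bar>) * W \<omega>) \<partial>N)"
    proof -
      have "(\<Sum>n. ennreal (m n * \<bar>r\<bar> ^ n)) = ennreal (\<integral>\<omega>. g \<omega> * exp (- (1 - \<bar>r\<bar>) * W \<omega>) \<partial>N)"
        unfolding nn[OF abs_ge_zero, symmetric] using that g0
        by (intro nn_integral_eq_integral int1 AE_I2) auto
      then show ?thesis
        using m0 g0 by (subst sums_ennreal[symmetric])
          (auto simp: sums_iff intro!: integral_nonneg_AE AE_I2)
    qed
    then have summ: "summable (\<lambda>n. m n * \<bar>r\<bar> ^ n)" by (rule sums_summable)
    have "(\<lambda>n. \<integral>\<omega>. h n \<omega> * r ^ n \<partial>N) sums (\<integral>\<omega>. (\<Sum>n. h n \<omega> * r ^ n) \<partial>N)"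
    proof (rule sums_integral)
      show "integrable N (\<lambda>\<omega>. h n \<omega> * r ^ n)" for n using inth by auto
      show "AE \<omega> in N. summable (\<lambda>n. norm (h n \<omega> * r ^ n))"
      proof (rule AE_I2)
        fix \<omega> assume "\<omega> \<in> space N"
        then show "summable (\<lambda>n. norm (h n \<omega> * r ^ n))"
          using sums_summable[OF exp_sums[of \<omega> "\<bar>r\<bar>"]] h0
          by (simp add: abs_mult power_abs)
      qed
      have "(\<integral>\<omega>. norm (h n \<omega> * r ^ n) \<partial>N) = m n * \<bar>r\<bar> ^ n" for n
      proof -
        have "(\<integral>\<omega>. norm (h n \<omega> * r ^ n) \<partial>N) = (\<integral>\<omega>. h n \<omega> * \<bar>r\<bar> ^ n \<partial>N)"
          using h0 by (intro Bochner_Integration.integral_cong) (auto simp: abs_mult power_abs)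
        then show ?thesis by (simp add: m_def)
      qed
      then show "summable (\<lambda>n. \<integral>\<omega>. norm (h n \<omega> * r ^ n) \<partial>N)" using summ by simp
    qed
    then have "(\<lambda>n. m n * r ^ n) sums (\<integral>\<omega>. g \<omega> * exp (- (1 - r) * W \<omega>) \<partial>N)"
      using exp_sums by (simp add: m_def sums_iff)
    then show ?thesis using lap[of "1 - r"] that by simp
  qed
  \<comment> \<open>Binomial coefficients of (c + d - d r) powr -\<alpha>. Since 0 < c the series
    converges beyond r = 1, and r = 1 + b is admissible exactly when b d < c.\<close>
  define e where "e n = ((- \<alpha>) gchoose n) * (- d) ^ n * (c + d) powr (- \<alpha> - real n)" for n
  have eq: "(- (d * r)) ^ n = (- d) ^ n * r ^ n" for r n
    by (simp flip: power_mult_distrib)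
  have e_sums: "(\<lambda>n. e n * r ^ n) sums (c + d * (1 - r)) powr - \<alpha>" if "\<bar>r * d\<bar> < c + d" for r
    using gen_binomial_real'[of "- (r * d)" "c + d" "- \<alpha>"] that
    by (simp add: e_def eq mult_ac right_diff_distrib add_diff_eq)
  have "m = e"
  proof (rule powser_coeff_unique[OF _ m_sums e_sums])
    show "\<bar>x * d\<bar> < c + d" if "\<bar>x\<bar> < 1" for x
    proof -
      have "\<bar>x * d\<bar> \<le> 1 * d" using that \<open>0 \<le> d\<close> unfolding abs_mult
        by (intro mult_mono) auto
      then show ?thesis using \<open>0 < c\<close> by simp
    qed
  qed auto
  moreover have "(\<lambda>n. e n * (1 + b) ^ n) sums (c - b * d) powr - \<alpha>"
    using e_sums[of "1 + b"] assms by (simp add: algebra_simps)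
  ultimately show ?thesis
    using nn[of "1 + b"] m0 \<open>0 \<le> b\<close> by (simp add: suminf_ennreal_eq sums_iff)
qed

section \<open>One-point and two-point Laplace transforms and their tails\<close>

lemma det_two:
  fixes A :: "'a :: comm_ring_1 mat"
  assumes "A \<in> carrier_mat 2 2"
  shows "Determinant.det A = A $$ (0,0) * A $$ (1,1) - A $$ (0,1) * A $$ (1,0)"
proof -
  have "Determinant.det A = (\<Sum>i<2. A $$ (i, 0) * cofactor A i 0)"
    using assms by (intro laplace_expansion_column) auto
  also have "\<dots> = A $$ (0,0) * A $$ (1,1) - A $$ (0,1) * A $$ (1,0)"
    using assms by (simp add: numeral_2_eq_2 cofactor_def mat_delete_def det_single)
  finally show ?thesis .
qed

lemma permanental_laplace:
  assumes "permanental_process N \<alpha> K I X" "\<And>i. i < n \<Longrightarrow> t i \<in> I" "\<And>i. i < n \<Longrightarrow> 0 < s i"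
  shows "(\<integral>\<omega>. exp (- (\<Sum>i<n. s i * X (t i) \<omega>)) \<partial>N) =
    Determinant.det (1\<^sub>m n + Matrix.mat n n (\<lambda>(i, j). K (t i) (t j) * s j)) powr - \<alpha>"
proof -
  have "(\<integral>\<omega>. exp (- (\<Sum>i<n. s i * X (t i) \<omega>)) \<partial>N) =
      1 / Determinant.det (1\<^sub>m n + Matrix.mat n n (\<lambda>(i, j). K (t i) (t j)) * mat_diag n s) powr \<alpha>"
    using assms by (simp add: permanental_process_def)
  also have "Matrix.mat n n (\<lambda>(i, j). K (t i) (t j)) * mat_diag n s =
      Matrix.mat n n (\<lambda>(i, j). K (t i) (t j) * s j)"
    by (subst mat_diag_mult_right[of _ n n]) (auto intro!: eq_matI)
  finally show ?thesis by (simp add: powr_minus_divide)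
qed

lemma permanental_laplace_one:
  assumes "permanental_process N \<alpha> K I X" "t \<in> I" "0 < a"
  shows "(\<integral>\<omega>. exp (- (a * X t \<omega>)) \<partial>N) = (1 + a * K t t) powr - \<alpha>"
  using permanental_laplace[OF assms(1), of 1 "\<lambda>_. t" "\<lambda>_. a"] assms
  by (simp add: det_single mult.commute)

lemma permanental_laplace_two:
  assumes "permanental_process N \<alpha> K I X" "s \<in> I" "t \<in> I" "0 < a" "0 < b"
  shows "(\<integral>\<omega>. exp (- (a * X s \<omega> + b * X t \<omega>)) \<partial>N) =
    (1 + a * K s s + b * K t t + a * b * (K s s * K t t - K s t * K t s)) powr - \<alpha>"
proof -
  have sum2: "(\<Sum>i<2. f i) = f 0 + f 1" for f :: "nat \<Rightarrow> real"
    by (simp add: numeral_2_eq_2)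
  show ?thesis
    using permanental_laplace[OF assms(1), of 2 "\<lambda>i. if i = 0 then s else t" "\<lambda>i. if i = 0 then a else b"] assms
    by (simp add: det_two sum2 algebra_simps)
qed

text \<open>Chernoff's bound. With a nonnegative integral, the hypothesis itself says that the
  moment is finite.\<close>

lemma (in finite_measure) measure_gt_le_exp_moment:
  assumes [measurable]: "W \<in> borel_measurable M"
    and bound: "(\<integral>\<^sup>+\<omega>. ennreal (exp (b * W \<omega>)) \<partial>M) \<le> ennreal B"
    and "0 < b" "0 \<le> B"
  shows "measure M {\<omega> \<in> space M. x < W \<omega>} \<le> B * exp (- (b * x))"
proof -
  have "emeasure M {\<omega> \<in> space M. x < W \<omega>} \<le>
      emeasure M {\<omega> \<in> space M. 1 \<le> ennreal (exp (- (b * x))) * ennreal (exp (b * W \<omega>))}"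
    using \<open>0 < b\<close>
    by (intro emeasure_mono)
      (auto simp: ennreal_mult[symmetric] exp_add[symmetric] intro: less_imp_le)
  also have "\<dots> \<le> ennreal (exp (- (b * x))) * (\<integral>\<^sup>+\<omega>. ennreal (exp (b * W \<omega>)) \<partial>M)"
    by (rule nn_integral_Markov_inequality[of _ "space M" M, THEN order_trans])
      (auto intro!: mult_left_mono nn_integral_mono simp: indicator_def)
  also have "\<dots> \<le> ennreal (exp (- (b * x))) * ennreal B"
    by (intro mult_left_mono bound) auto
  finally show ?thesis
    using \<open>0 \<le> B\<close> by (simp add: emeasure_eq_measure ennreal_mult[symmetric] mult.commute)
qed

text \<open>\<open>X t\<close> has a gamma transform, which continues up to the pole b = 1 / K t t.
  The prefactor depends only on the margin \<epsilon> kept from the pole, so it is uniform in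
  t.\<close>

lemma permanental_tail:
  assumes perm: "permanental_process N \<alpha> K I X" and "t \<in> I" "0 < \<alpha>"
    and "0 \<le> K t t" "0 < b" "0 < \<epsilon>" "b * K t t \<le> 1 - \<epsilon>"
  shows "measure N {\<omega> \<in> space N. x < X t \<omega>} \<le> \<epsilon> powr - \<alpha> * exp (- (b * x))"
proof -
  from perm interpret prob_space N by (simp add: permanental_process_def)
  have m: "X t \<in> borel_measurable N" and nonneg: "\<And>\<omega>. \<omega> \<in> space N \<Longrightarrow> 0 \<le> X t \<omega>"
    using perm \<open>t \<in> I\<close> by (auto simp: permanental_process_def)
  have "(\<integral>\<^sup>+\<omega>. ennreal (1 * exp (b * X t \<omega>)) \<partial>N) = ennreal ((1 - b * K t t) powr - \<alpha>)"
    using assms permanental_laplace_one[OF perm \<open>t \<in> I\<close>]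
    by (intro exp_moment_from_laplace_transform m nonneg) (auto simp: mult.commute)
  also have "\<dots> \<le> ennreal (\<epsilon> powr - \<alpha>)"
    using assms by (intro ennreal_leI powr_mono2') auto
  finally show ?thesis
    using \<open>0 < b\<close> by (intro measure_gt_le_exp_moment m) auto
qed

text \<open>The factor \<open>exp (- (a * X s \<omega>))\<close> serves as the weight
  \<open>g\<close>, so only the argument of \<open>X t\<close> has to be continued to -a. For fixed
  a the two-point determinant is affine in that argument, which is the form the continuation lemma
  needs.\<close>

lemma permanental_increment_exp_moment:
  fixes K :: "real \<Rightarrow> real \<Rightarrow> real"
  defines "\<Delta> \<equiv> \<lambda>s t. K s s * K t t - K s t * K t s"
  assumes perm: "permanental_process N \<alpha> K I X" and "s \<in> I" "t \<in> I" "0 < \<alpha>"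
    and "0 \<le> K s s" "0 \<le> K t t" "0 \<le> \<Delta> s t" "0 < a"
    and "a * (K t t - K s s) \<le> 1/4" "a\<^sup>2 * \<Delta> s t \<le> 1/4"
  shows "(\<integral>\<^sup>+\<omega>. ennreal (exp (a * (X t \<omega> - X s \<omega>))) \<partial>N) \<le> ennreal (2 powr \<alpha>)"
proof -
  from perm interpret prob_space N by (simp add: permanental_process_def)
  have [measurable]: "X r \<in> borel_measurable N" if "r \<in> {s, t}" for r
    using perm that \<open>s \<in> I\<close> \<open>t \<in> I\<close> by (auto simp: permanental_process_def)
  have nonneg: "0 \<le> X r \<omega>" if "r \<in> {s, t}" "\<omega> \<in> space N" for r \<omega>
    using perm that \<open>s \<in> I\<close> \<open>t \<in> I\<close> by (auto simp: permanental_process_def)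
  have int: "integrable N (\<lambda>\<omega>. exp (- (a * X s \<omega>)))"
    using nonneg \<open>0 < a\<close> by (intro integrable_const_bound[where B = 1] AE_I2) auto
  \<comment> \<open>At argument -a the determinant is 1 - a (K t t - K s s) - a^2
    \<open>\<Delta> s t\<close>. The two quarters in the hypotheses keep it at least 1/2, whence the
    bound 2 powr \<alpha>.\<close>
  have c: "1 + a * K s s - a * (K t t + a * \<Delta> s t) \<ge> 1/2"
    using assms(10,11) by (simp add: algebra_simps power2_eq_square)
  have "(\<integral>\<^sup>+\<omega>. ennreal (exp (- (a * X s \<omega>)) * exp (a * X t \<omega>)) \<partial>N) =
      ennreal ((1 + a * K s s - a * (K t t + a * \<Delta> s t)) powr - \<alpha>)"
  proof (rule exp_moment_from_laplace_transform[OF int])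
    fix r :: real assume "0 < r"
    show "(\<integral>\<omega>. exp (- (a * X s \<omega>)) * exp (- r * X t \<omega>) \<partial>N) =
        (1 + a * K s s + (K t t + a * \<Delta> s t) * r) powr - \<alpha>"
      using permanental_laplace_two[OF perm \<open>s \<in> I\<close> \<open>t \<in> I\<close> \<open>0 < a\<close> \<open>0 < r\<close>]
      by (simp add: \<Delta>_def exp_add[symmetric] algebra_simps)
  qed (use assms c nonneg in \<open>auto simp: add_pos_nonneg\<close>)
  also have "\<dots> \<le> ennreal ((1/2) powr - \<alpha>)"
    using c \<open>0 < \<alpha>\<close> by (intro ennreal_leI powr_mono2') auto
  also have "(1/2) powr - \<alpha> = 2 powr \<alpha>" by (simp add: powr_divide powr_minus)
  finally show ?thesis by (simp add: exp_add[symmetric] right_diff_distrib)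
qed

text \<open>The other sign of the increment follows by exchanging s and t, since
  \<open>\<Delta>\<close> is symmetric even where \<open>K\<close> is not.\<close>

lemma permanental_increment_tail:
  fixes K :: "real \<Rightarrow> real \<Rightarrow> real"
  defines "\<Delta> \<equiv> \<lambda>s t. K s s * K t t - K s t * K t s"
  assumes perm: "permanental_process N \<alpha> K I X" and I: "s \<in> I" "t \<in> I" and "0 < \<alpha>"
    and K: "0 \<le> K s s" "0 \<le> K t t" "0 \<le> \<Delta> s t" and "0 < a"
    and a: "a * \<bar>K t t - K s s\<bar> \<le> 1/4" "a\<^sup>2 * \<Delta> s t \<le> 1/4"
  shows "measure N {\<omega> \<in> space N. x < \<bar>X t \<omega> - X s \<omega>\<bar>} \<le> 2 * 2 powr \<alpha> * exp (- (a * x))"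
proof -
  from perm interpret prob_space N by (simp add: permanental_process_def)
  have m[measurable]: "X s \<in> borel_measurable N" "X t \<in> borel_measurable N"
    using perm I by (auto simp: permanental_process_def)
  have "a * (K t t - K s s) \<le> a * \<bar>K t t - K s s\<bar>" "a * (K s s - K t t) \<le> a * \<bar>K t t - K s s\<bar>"
    using \<open>0 < a\<close> by (auto intro: mult_left_mono)
  with a have a': "a * (K t t - K s s) \<le> 1/4" "a * (K s s - K t t) \<le> 1/4" by auto
  have \<Delta>: "\<Delta> t s = \<Delta> s t" by (simp add: \<Delta>_def mult.commute)
  have 1: "measure N {\<omega> \<in> space N. x < X t \<omega> - X s \<omega>} \<le> 2 powr \<alpha> * exp (- (a * x))"
    using permanental_increment_exp_moment[OF perm I, of a] assms a'
    by (intro measure_gt_le_exp_moment) auto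
  have 2: "measure N {\<omega> \<in> space N. x < X s \<omega> - X t \<omega>} \<le> 2 powr \<alpha> * exp (- (a * x))"
    using permanental_increment_exp_moment[OF perm I(2,1), of a] assms a' \<Delta>
    by (intro measure_gt_le_exp_moment) (auto simp: mult.commute)
  have "measure N {\<omega> \<in> space N. x < \<bar>X t \<omega> - X s \<omega>\<bar>} \<le>
      measure N ({\<omega> \<in> space N. x < X t \<omega> - X s \<omega>} \<union> {\<omega> \<in> space N. x < X s \<omega> - X t \<omega>})"
    by (intro finite_measure_mono) auto
  also have "\<dots> \<le> measure N {\<omega> \<in> space N. x < X t \<omega> - X s \<omega>} +
      measure N {\<omega> \<in> space N. x < X s \<omega> - X t \<omega>}"
    by (intro measure_Un_le) auto
  finally show ?thesis using 1 2 by simp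
qed

section \<open>Dyadic chaining\<close>

text \<open>Each level costs at most one step: a node with even index is already a node of the
  previous level, and a node with odd index is one step to the right of such a node.\<close>

lemma dyadic_chaining:
  fixes g :: "nat \<Rightarrow> nat \<Rightarrow> real"
  assumes refine: "\<And>n i. g (Suc n) (2 * i) = g n i"
    and step: "\<And>n i. i < 2 ^ n \<Longrightarrow> \<bar>g n (Suc i) - g n i\<bar> \<le> r n"
    and "i \<le> 2 ^ n"
  shows "\<bar>g n i - g 0 0\<bar> \<le> (\<Sum>k\<le>n. r k)"
  using \<open>i \<le> 2 ^ n\<close>
proof (induction n arbitrary: i)
  case 0
  then have "i = 0 \<or> i = 1" by auto
  then show ?case using step[of 0 0] by auto
next
  case (Suc n)
  show ?case
  proof (cases "even i")
    case True
    then obtain j where "i = 2 * j" by (elim evenE)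
    \<comment> \<open>No step is made on this level, so its allowance has to be nonnegative.\<close>
    moreover have "0 \<le> r (Suc n)" using step[of 0 "Suc n"] by simp
    ultimately show ?thesis using Suc.IH[of j] Suc.prems by (simp add: refine)
  next
    case False
    then obtain j where j: "i = 2 * j + 1" by (elim oddE)
    then have "2 * j < 2 ^ Suc n" "j \<le> 2 ^ n" using Suc.prems by auto
    with step[of "2 * j" "Suc n"] Suc.IH[of j] show ?thesis by (simp add: j refine)
  qed
qed

text \<open>Level n has 2^n increments of relative scale sqrt (1/2)^n. Exponential tails outweigh
  this number if the thresholds are n + 1 times the scale; the constant is the sum of these
  thresholds.\<close>

definition chaining_const :: real where
  "chaining_const = (\<Sum>n. (real n + 1) * sqrt (1/2) ^ n)"

lemma sqrt_half: "0 < sqrt (1/2 :: real)" "sqrt (1/2 :: real) < 1"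
  by (auto simp: real_sqrt_lt_1_iff)

lemma summable_chaining: "summable (\<lambda>n. (real n + 1) * sqrt (1/2) ^ n)"
  using geometric_deriv_sums[of "sqrt (1/2 :: real)"] sqrt_half
  by (intro sums_summable) (auto simp: add.commute)

lemma chaining_const_partial_sum: "(\<Sum>k\<le>n. (real k + 1) * sqrt (1/2) ^ k) \<le> chaining_const"
  unfolding chaining_const_def using sqrt_half
  by (intro sum_le_suminf summable_chaining) auto

lemma chaining_const_pos: "0 < chaining_const"
  using chaining_const_partial_sum[of 0] by simp

text \<open>Each of the 2^n increments of level n exceeds its threshold with probability at most C
  exp (-y)^(n+1). For y at least ln 4 the union over the level costs at most C exp (-y) (1/2)^n, and
  summing over the levels gives the factor 2.\<close>

lemma (in prob_space) dyadic_maximal_inequality: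
  fixes X :: "real \<Rightarrow> 'a \<Rightarrow> real"
  assumes meas: "\<And>t. t \<in> {u..u + l} \<Longrightarrow> X t \<in> borel_measurable M"
    and tail: "\<And>s t x. u \<le> s \<Longrightarrow> s < t \<Longrightarrow> t \<le> u + l \<Longrightarrow> 0 \<le> x \<Longrightarrow>
      prob {\<omega> \<in> space M. x < \<bar>X t \<omega> - X s \<omega>\<bar>} \<le> C * exp (- (x / (\<sigma> * sqrt ((t - s) / l))))"
    and "0 < l" "0 < \<sigma>" "ln 4 \<le> y"
  defines "E \<equiv> {\<omega> \<in> space M. \<exists>n. \<exists>i\<le>2 ^ n.
      y * \<sigma> * chaining_const < \<bar>X (u + real i / 2 ^ n * l) \<omega> - X u \<omega>\<bar>}"
  shows "E \<in> sets M" and "prob E \<le> 2 * C * exp (- y)"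
proof -
  let ?p = "\<lambda>n i. u + real i / 2 ^ n * l"
  have p_in: "?p n i \<in> {u..u + l}" if "i \<le> 2 ^ n" for n i
    using that \<open>0 < l\<close> by (auto simp: field_simps)
  have "0 \<le> ln (4::real)" by simp
  then have "0 \<le> y" using \<open>ln 4 \<le> y\<close> by linarith
  have E: "E = (\<Union>n. \<Union>i\<in>{..2 ^ n}.
      {\<omega> \<in> space M. y * \<sigma> * chaining_const < \<bar>X (?p n i) \<omega> - X u \<omega>\<bar>})"
    by (auto simp: E_def)
  show "E \<in> sets M"
    unfolding E
  proof (intro sets.countable_UN'')
    fix n i assume "i \<in> {..2 ^ n :: nat}"
    then have [measurable]: "X (?p n i) \<in> borel_measurable M" "X u \<in> borel_measurable M"
      using p_in[of i n] \<open>0 < l\<close> by (auto intro: meas)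
    show "{\<omega> \<in> space M. y * \<sigma> * chaining_const < \<bar>X (?p n i) \<omega> - X u \<omega>\<bar>} \<in> sets M"
      by measurable
  qed auto
  define r where "r n = y * \<sigma> * ((real n + 1) * sqrt (1/2) ^ n)" for n
  define B where "B n i = {\<omega> \<in> space M. r n < \<bar>X (?p n (Suc i)) \<omega> - X (?p n i) \<omega>\<bar>}" for n i
  have Bm: "B n i \<in> sets M" if "i < 2 ^ n" for n i
  proof -
    have [measurable]: "X (?p n i) \<in> borel_measurable M" "X (?p n (Suc i)) \<in> borel_measurable M"
      using p_in[of i n] p_in[of "Suc i" n] that by (auto intro!: meas)
    show ?thesis unfolding B_def by measurable
  qed
  have pB: "prob (B n i) \<le> C * exp (- y) * exp (- y) ^ n" if "i < 2 ^ n" for n i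
  proof -
    have diff: "(?p n (Suc i) - ?p n i) / l = (1/2) ^ n"
      using \<open>0 < l\<close> by (simp add: field_simps)
    have "prob (B n i) \<le> C * exp (- (r n / (\<sigma> * sqrt ((?p n (Suc i) - ?p n i) / l))))"
      unfolding B_def using p_in[of i n] p_in[of "Suc i" n] that \<open>0 < l\<close> \<open>0 < \<sigma>\<close> \<open>0 \<le> y\<close>
      by (intro tail) (auto simp: r_def intro!: mult_strict_right_mono divide_strict_right_mono)
    also have "r n / (\<sigma> * sqrt ((?p n (Suc i) - ?p n i) / l)) = y + real n * y"
      unfolding diff real_sqrt_power r_def using sqrt_half(1) \<open>0 < \<sigma>\<close> by (simp add: field_simps)
    also have "exp (- (y + real n * y)) = exp (- y) * exp (- y) ^ n"
      by (simp add: exp_of_nat_mult[symmetric] exp_add[symmetric])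
    finally show ?thesis by (simp add: mult.assoc)
  qed
  define D where "D n = (\<Union>i\<in>{..<2 ^ n}. B n i)" for n
  have Dm: "D n \<in> sets M" for n
    unfolding D_def using Bm by (intro sets.finite_UN) auto
  \<comment> \<open>The sign is read off from the probability bound at level 0.\<close>
  have "0 \<le> C * exp (- y)"
    using pB[of 0 0] measure_nonneg[of M "B 0 0"] by (simp del: measure_nonneg)
  have pD: "prob (D n) \<le> C * exp (- y) * (1/2) ^ n" for n
  proof -
    have "prob (D n) \<le> (\<Sum>i<2 ^ n. prob (B n i))"
      unfolding D_def using Bm by (intro finite_measure_subadditive_finite) auto
    also have "\<dots> \<le> (\<Sum>i<(2::nat) ^ n. C * exp (- y) * exp (- y) ^ n)"
      using pB by (intro sum_mono) auto
    also have "\<dots> = C * exp (- y) * (2 * exp (- y)) ^ n"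
      by (simp add: power_mult_distrib)
    also have "\<dots> \<le> C * exp (- y) * (1/2) ^ n"
    proof (intro mult_left_mono power_mono)
      have "exp (- y) \<le> exp (- ln 4)" using \<open>ln 4 \<le> y\<close> by simp
      also have "\<dots> = 1/4" by (simp add: exp_minus)
      finally show "2 * exp (- y) \<le> 1/2" by simp
    qed (use \<open>0 \<le> C * exp (- y)\<close> in auto)
    finally show ?thesis .
  qed
  have geo: "(\<lambda>n. C * exp (- y) * (1/2) ^ n) sums (C * exp (- y) * 2)"
    using geometric_sums[of "1/2::real"] by (intro sums_mult) simp
  have summ: "summable (\<lambda>n. prob (D n))"
    using pD by (intro summable_comparison_test'[OF sums_summable[OF geo], of 0]) auto
  have "E \<subseteq> (\<Union>n. D n)"
  proof (rule ccontr)
    assume "\<not> E \<subseteq> (\<Union>n. D n)"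
    then obtain \<omega> where \<omega>: "\<omega> \<in> E" "\<And>n. \<omega> \<notin> D n" by auto
    then obtain n i where ni: "i \<le> 2 ^ n" "y * \<sigma> * chaining_const < \<bar>X (?p n i) \<omega> - X u \<omega>\<bar>"
      by (auto simp: E_def)
    have "\<bar>X (?p n i) \<omega> - X (?p 0 0) \<omega>\<bar> \<le> (\<Sum>k\<le>n. r k)"
    proof (rule dyadic_chaining[where g = "\<lambda>n i. X (?p n i) \<omega>"])
      show "\<bar>X (?p n (Suc i)) \<omega> - X (?p n i) \<omega>\<bar> \<le> r n" if "i < 2 ^ n" for n i
        using \<omega>(2)[of n] \<omega>(1) that by (force simp: D_def B_def E_def)
    qed (use ni in \<open>auto simp: field_simps\<close>)
    also have "\<dots> = y * \<sigma> * (\<Sum>k\<le>n. (real k + 1) * sqrt (1/2) ^ k)"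
      by (simp add: r_def sum_distrib_left)
    also have "\<dots> \<le> y * \<sigma> * chaining_const"
      using \<open>0 \<le> y\<close> \<open>0 < \<sigma>\<close> by (intro mult_left_mono chaining_const_partial_sum) auto
    finally show False using ni by simp
  qed
  then have "prob E \<le> prob (\<Union>n. D n)" using Dm by (intro finite_measure_mono) auto
  also have "\<dots> \<le> (\<Sum>n. prob (D n))"
    using Dm summ by (intro finite_measure_subadditive_countably) auto
  also have "\<dots> \<le> C * exp (- y) * 2"
    using sums_summable[OF geo] sums_unique[OF geo] pD summ by (metis suminf_le)
  finally show "prob E \<le> 2 * C * exp (- y)" by simp
qed

section \<open>Dyadic approximation and extension by limits\<close>

definition dyadic_floor :: "nat \<Rightarrow> real \<Rightarrow> real" where
  "dyadic_floor n t = of_int \<lfloor>2 ^ n * t\<rfloor> / 2 ^ n"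

lemma dyadic_floor_le: "dyadic_floor n t \<le> t"
  by (simp add: dyadic_floor_def field_simps)

lemma dyadic_floor_gt: "t - 1 / 2 ^ n < dyadic_floor n t"
proof -
  have "2 ^ n * t - 1 < of_int \<lfloor>2 ^ n * t\<rfloor>" by linarith
  then have "(2 ^ n * t - 1) / 2 ^ n < of_int \<lfloor>2 ^ n * t\<rfloor> / 2 ^ n"
    by (intro divide_strict_right_mono) auto
  then show ?thesis by (simp add: dyadic_floor_def diff_divide_distrib)
qed

lemma dyadic_floor_nonneg: "0 \<le> t \<Longrightarrow> 0 \<le> dyadic_floor n t"
  by (simp add: dyadic_floor_def)

text \<open>The limit at t stays within w m of the value at the level-m floor of t, and floors of
  points closer than 2^-m are equal or adjacent. Hence nearby limits differ by at most 3 w m. Only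
  values of g at dyadic points enter.\<close>

lemma continuous_on_lim_dyadic_floor:
  fixes g :: "real \<Rightarrow> real"
  assumes w: "w \<longlonglongrightarrow> 0"
    and osc: "\<forall>\<^sub>F m in sequentially. \<forall>j<2 ^ m. \<forall>n. \<forall>i\<le>2 ^ n.
      \<bar>g (real j / 2 ^ m + real i / 2 ^ n * (1 / 2 ^ m)) - g (real j / 2 ^ m)\<bar> \<le> w m"
  shows "continuous_on {0..1} (\<lambda>t. lim (\<lambda>n. g (dyadic_floor n t)))"
proof -
  let ?d = dyadic_floor
  let ?L = "\<lambda>t. lim (\<lambda>n. g (?d n t))"
  obtain M where M: "\<And>m j n i. M \<le> m \<Longrightarrow> j < 2 ^ m \<Longrightarrow> i \<le> 2 ^ n \<Longrightarrow>
      \<bar>g (real j / 2 ^ m + real i / 2 ^ n * (1 / 2 ^ m)) - g (real j / 2 ^ m)\<bar> \<le> w m"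
    using osc unfolding eventually_sequentially by blast
  have w0: "0 \<le> w m" if "M \<le> m" for m using M[OF that, of 0 0 0] by simp
  have refine: "\<bar>g (?d (m + n) t) - g (?d m t)\<bar> \<le> w m" if "M \<le> m" "t \<in> {0..1}" for m n t
  \<comment> \<open>The point 1 lies in no half-open interval [j / 2^m, (j + 1) / 2^m) with j < 2^m,
    but it is its own floor at every level.\<close>
  proof (cases "t = 1")
    case True
    have "?d k 1 = 1" for k
      using floor_of_int[of "2 ^ k"] by (simp add: dyadic_floor_def del: floor_of_int)
    then show ?thesis using True w0 that by simp
  next
    case False
    define j where "j = nat \<lfloor>2 ^ m * t\<rfloor>"
    define k where "k = nat \<lfloor>2 ^ (m + n) * t\<rfloor>"
    have j: "real j \<le> 2 ^ m * t" "2 ^ m * t < real j + 1" and dj: "?d m t = real j / 2 ^ m"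
      using that by (auto simp: j_def dyadic_floor_def)
    have k: "real k \<le> 2 ^ (m + n) * t" "2 ^ (m + n) * t < real k + 1"
      and dk: "?d (m + n) t = real k / 2 ^ (m + n)"
      using that by (auto simp: k_def dyadic_floor_def)
    have "2 ^ m * t < 2 ^ m * 1" using that False by (intro mult_strict_left_mono) auto
    then have "real j < 2 ^ m" using j by linarith
    then have j2: "j < 2 ^ m" by simp
    have split: "2 ^ (m + n) * t = 2 ^ n * (2 ^ m * t)" by (simp add: power_add)
    have "2 ^ n * real j \<le> 2 ^ n * (2 ^ m * t)" using j by (intro mult_left_mono) auto
    then have "2 ^ n * real j < real k + 1" using k split by linarith
    then have "real (2 ^ n * j) < real (Suc k)" by simp
    then have jk: "2 ^ n * j \<le> k" unfolding of_nat_less_iff by simp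
    have "2 ^ n * (2 ^ m * t) < 2 ^ n * (real j + 1)" using j by (intro mult_strict_left_mono) auto
    then have "real k < 2 ^ n * (real j + 1)" using k split by linarith
    then have "real k < real (2 ^ n * j + 2 ^ n)" by (simp add: algebra_simps)
    then have kj: "k < 2 ^ n * j + 2 ^ n" unfolding of_nat_less_iff .
    have "?d (m + n) t = real j / 2 ^ m + real (k - 2 ^ n * j) / 2 ^ n * (1 / 2 ^ m)"
      using jk by (simp add: dk of_nat_diff power_add field_simps)
    with M[OF \<open>M \<le> m\<close> j2, of "k - 2 ^ n * j" n] kj show ?thesis by (simp add: dj)
  qed
  have conv: "(\<lambda>n. g (?d n t)) \<longlonglongrightarrow> ?L t" if "t \<in> {0..1}" for t
  proof -
    have "Cauchy (\<lambda>n. g (?d n t))"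
    proof (rule metric_CauchyI)
      fix e :: real assume "0 < e"
      then have "\<forall>\<^sub>F m in sequentially. w m < e / 2 \<and> M \<le> m"
        using w by (intro eventually_conj eventually_ge_at_top order_tendstoD(2)) auto
      then obtain m where m: "w m < e / 2" "M \<le> m" by (auto simp: eventually_sequentially)
      have near: "\<bar>g (?d k t) - g (?d m t)\<bar> < e / 2" if "m \<le> k" for k
        using refine[OF m(2) \<open>t \<in> {0..1}\<close>, of "k - m"] that m(1) by simp
      show "\<exists>K. \<forall>i\<ge>K. \<forall>j\<ge>K. dist (g (?d i t)) (g (?d j t)) < e"
      proof (intro exI allI impI)
        fix i j assume "m \<le> i" "m \<le> j"
        from near[OF this(1)] near[OF this(2)] show "dist (g (?d i t)) (g (?d j t)) < e"
          unfolding dist_real_def by linarith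
      qed
    qed
    then show ?thesis by (simp add: Cauchy_convergent_iff convergent_LIMSEQ_iff)
  qed
  have L: "\<bar>?L t - g (?d m t)\<bar> \<le> w m" if "M \<le> m" "t \<in> {0..1}" for m t
  proof (rule LIMSEQ_le_const2)
    show "(\<lambda>n. \<bar>g (?d n t) - g (?d m t)\<bar>) \<longlonglongrightarrow> \<bar>?L t - g (?d m t)\<bar>"
      by (intro tendsto_intros conv that)
    show "\<exists>N. \<forall>n\<ge>N. \<bar>g (?d n t) - g (?d m t)\<bar> \<le> w m"
      using refine[OF that] by (metis le_Suc_ex)
  qed
  have coarse: "\<bar>g (?d m t) - g (?d m s)\<bar> \<le> w m"
    if "M \<le> m" "0 \<le> s" "s \<le> t" "t \<le> 1" "t - s < 1 / 2 ^ m" for m s t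
  proof -
    define j where "j = nat \<lfloor>2 ^ m * s\<rfloor>"
    define k where "k = nat \<lfloor>2 ^ m * t\<rfloor>"
    have j: "real j \<le> 2 ^ m * s" "2 ^ m * s < real j + 1" and dj: "?d m s = real j / 2 ^ m"
      using that by (auto simp: j_def dyadic_floor_def)
    have k: "real k \<le> 2 ^ m * t" "2 ^ m * t < real k + 1" and dk: "?d m t = real k / 2 ^ m"
      using that by (auto simp: k_def dyadic_floor_def)
    have "2 ^ m * s \<le> 2 ^ m * t" "2 ^ m * t < 2 ^ m * s + 1" "2 ^ m * t \<le> 2 ^ m * 1"
      using that by (auto simp: field_simps)
    then have "real j < real k + 1" "real k < real j + 2" "real k \<le> 2 ^ m"
      using j k by linarith+
    then have "j \<le> k" "k \<le> j + 1" "k \<le> 2 ^ m" by (linarith, linarith, simp)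
    then consider "k = j" | "k = j + 1" "j < 2 ^ m" by linarith
    then show ?thesis
    proof cases
      case 1 then show ?thesis using w0 that by (simp add: dj dk)
    next
      case 2
      \<comment> \<open>The adjacent node is the right endpoint of the interval: i = 1, n =
        0.\<close>
      then show ?thesis using M[OF that(1) 2(2), of 1 0]
        by (simp add: dj dk add_divide_distrib add.commute)
    qed
  qed
  have unif: "\<exists>d>0. \<forall>s\<in>{0..1}. \<forall>t\<in>{0..1}. dist t s < d \<longrightarrow> dist (?L t) (?L s) < e"
    if "0 < e" for e
  proof -
    from that have "\<forall>\<^sub>F m in sequentially. w m < e / 3 \<and> M \<le> m"
      using w by (intro eventually_conj eventually_ge_at_top order_tendstoD(2)) auto
    then obtain m where m: "w m < e / 3" "M \<le> m" by (auto simp: eventually_sequentially)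
    have "dist (?L t) (?L s) < e" if st: "s \<in> {0..1}" "t \<in> {0..1}" "dist t s < 1 / 2 ^ m" for s t
    proof -
      have "\<bar>g (?d m t) - g (?d m s)\<bar> \<le> w m"
        using coarse[OF m(2), of s t] coarse[OF m(2), of t s] st
        by (cases "s \<le> t") (auto simp: dist_real_def abs_minus_commute)
      then show ?thesis
        using L[OF m(2) st(1)] L[OF m(2) st(2)] m(1) by (simp add: dist_real_def abs_le_iff abs_less_iff)
    qed
    then show ?thesis by (intro exI[of _ "1 / 2 ^ m"]) auto
  qed
  then show ?thesis
    unfolding continuous_on_iff by blast
qed

lemma sqrt_half_power: "sqrt (1 / 2 ^ n) = sqrt (1/2) ^ n"
  using real_sqrt_power[of "1/2" n] by (simp add: power_one_over)

text \<open>By continuity a bound at the countably many grid points, where the maximal inequality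
  speaks, holds at all times of the interval.\<close>

lemma dyadic_bound_imp_bound:
  fixes f :: "real \<Rightarrow> real"
  assumes cont: "continuous_on {u..u + l} f" and "0 < l"
    and dyadic: "\<And>n i. i \<le> 2 ^ n \<Longrightarrow> \<bar>f (u + real i / 2 ^ n * l) - f u\<bar> \<le> c"
    and t: "t \<in> {u..u + l}"
  shows "\<bar>f t - f u\<bar> \<le> c"
proof (rule LIMSEQ_le_const2)
  let ?s = "(t - u) / l"
  have s: "0 \<le> ?s" "?s \<le> 1" using t \<open>0 < l\<close> by auto
  have d: "dyadic_floor n ?s \<in> {0..1}" for n
    using dyadic_floor_le[of n ?s] dyadic_floor_nonneg[OF s(1), of n] s by auto
  let ?v = "\<lambda>n. u + dyadic_floor n ?s * l"
  have "(\<lambda>n. dyadic_floor n ?s) \<longlonglongrightarrow> ?s"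
  proof (rule tendsto_sandwich)
    show "\<forall>\<^sub>F n in sequentially. ?s - 1 / 2 ^ n \<le> dyadic_floor n ?s"
      using dyadic_floor_gt[of ?s] by (intro always_eventually allI less_imp_le)
    show "\<forall>\<^sub>F n in sequentially. dyadic_floor n ?s \<le> ?s" using dyadic_floor_le by auto
    show "(\<lambda>n. ?s - 1 / 2 ^ n) \<longlonglongrightarrow> ?s" by real_asymp
  qed auto
  then have "?v \<longlonglongrightarrow> u + ?s * l" by (intro tendsto_intros)
  then have "?v \<longlonglongrightarrow> t" using \<open>0 < l\<close> by simp
  moreover have "?v n \<in> {u..u + l}" for n
    using d[of n] \<open>0 < l\<close> by (auto intro: mult_left_le_one_le)
  ultimately have "(\<lambda>n. f (?v n)) \<longlonglongrightarrow> f t"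
    using continuous_on_tendsto_compose[OF cont _ t always_eventually] by blast
  then show "(\<lambda>n. \<bar>f (?v n) - f u\<bar>) \<longlonglongrightarrow> \<bar>f t - f u\<bar>" by (intro tendsto_intros)
  show "\<exists>N. \<forall>n\<ge>N. \<bar>f (?v n) - f u\<bar> \<le> c"
  proof (intro exI allI impI)
    fix n :: nat
    let ?i = "nat \<lfloor>2 ^ n * ?s\<rfloor>"
    have i: "real ?i / 2 ^ n = dyadic_floor n ?s"
    proof -
      have "0 \<le> 2 ^ n * ?s" using s(1) by (intro mult_nonneg_nonneg) auto
      then have "0 \<le> \<lfloor>2 ^ n * ?s\<rfloor>" by (simp only: zero_le_floor)
      then show ?thesis unfolding dyadic_floor_def by (simp only: of_nat_nat)
    qed
    then have "real ?i / 2 ^ n \<le> 1" using d[of n] by simp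
    then have "real ?i \<le> 2 ^ n" by simp
    then have "?i \<le> 2 ^ n" by simp
    from dyadic[OF this] show "\<bar>f (?v n) - f u\<bar> \<le> c" by (simp only: i)
  qed
qed

lemma geometric_scale_exists:
  fixes \<theta> t :: real
  assumes "0 < \<theta>" "\<theta> < 1" "0 < t" "t \<le> 1"
  obtains k where "\<theta> ^ Suc k < t" "t \<le> \<theta> ^ k"
proof -
  define n where "n = (LEAST n. \<theta> ^ n < t)"
  have ex: "\<exists>n. \<theta> ^ n < t" using assms by (intro real_arch_pow_inv)
  then have n: "\<theta> ^ n < t" unfolding n_def by (rule LeastI_ex)
  then have "n \<noteq> 0" using assms by (metis not_less power_0)
  then obtain k where k: "n = Suc k" by (auto simp: gr0_conv_Suc)
  moreover have "\<not> \<theta> ^ k < t"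
    using not_less_Least[of k "\<lambda>n. \<theta> ^ n < t"] k by (simp add: n_def)
  ultimately show ?thesis using n that by auto
qed

section \<open>Continuity and the law of the iterated logarithm\<close>

text \<open>The scale of an increment is sqrt (t (t - s)) / b. Bounding t by 1 suffices for
  continuity; keeping the factor t gives the sharp oscillation near 0.\<close>

locale sqrt_increment_tail = prob_space M for M :: "'a measure" +
  fixes X :: "real \<Rightarrow> 'a \<Rightarrow> real" and C b :: real
  assumes measurable_X: "\<And>t. t \<in> {0..1} \<Longrightarrow> X t \<in> borel_measurable M"
    and increment_tail: "\<And>s t x. 0 \<le> s \<Longrightarrow> s < t \<Longrightarrow> t \<le> 1 \<Longrightarrow> 0 \<le> x \<Longrightarrow>
      prob {\<omega> \<in> space M. x < \<bar>X t \<omega> - X s \<omega>\<bar>} \<le> C * exp (- (b * x / sqrt (t * (t - s))))"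
    and b_pos: "0 < b"
begin

lemma C_nonneg: "0 \<le> C"
  using increment_tail[of 0 1 0] measure_nonneg[of M "{\<omega> \<in> space M. 0 < \<bar>X 1 \<omega> - X 0 \<omega>\<bar>}"]
  by (simp del: measure_nonneg)

text \<open>Replacing t by the right end w and normalising by the length l puts the tail in the form
  of the maximal inequality, with \<sigma> = sqrt (w l) / b.\<close>

lemma increment_tail':
  assumes "0 \<le> s" "s < t" "t \<le> w" "w \<le> 1" "0 < l" "0 \<le> x"
  shows "prob {\<omega> \<in> space M. x < \<bar>X t \<omega> - X s \<omega>\<bar>} \<le>
    C * exp (- (x / (sqrt (w * l) / b * sqrt ((t - s) / l))))"
proof -
  have eq: "sqrt (w * l) / b * sqrt ((t - s) / l) = sqrt (w * (t - s)) / b"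
    using assms by (simp add: real_sqrt_mult real_sqrt_divide)
  have "prob {\<omega> \<in> space M. x < \<bar>X t \<omega> - X s \<omega>\<bar>} \<le> C * exp (- (b * x / sqrt (t * (t - s))))"
    using assms by (intro increment_tail) auto
  also have "b * x / sqrt (t * (t - s)) \<ge> b * x / sqrt (w * (t - s))"
    using assms b_pos by (intro divide_left_mono real_sqrt_le_mono mult_right_mono) auto
  then have "C * exp (- (b * x / sqrt (t * (t - s)))) \<le> C * exp (- (b * x / sqrt (w * (t - s))))"
    by (intro mult_left_mono C_nonneg) auto
  finally show ?thesis unfolding eq by (simp add: mult.commute)
qed

lemma dyadic_interval_maximal:
  assumes "0 \<le> u" "0 < l" "u + l \<le> 1" "ln 4 \<le> y"
  defines "E \<equiv> {\<omega> \<in> space M. \<exists>n. \<exists>i\<le>2 ^ n. y * (sqrt ((u + l) * l) / b) * chaining_const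
      < \<bar>X (u + real i / 2 ^ n * l) \<omega> - X u \<omega>\<bar>}"
  shows "E \<in> sets M" "prob E \<le> 2 * C * exp (- y)"
proof -
  have *: "t \<in> {u..u + l} \<Longrightarrow> X t \<in> borel_measurable M" for t
    using assms by (intro measurable_X) auto
  have **: "prob {\<omega> \<in> space M. x < \<bar>X t \<omega> - X s \<omega>\<bar>}
      \<le> C * exp (- (x / (sqrt ((u + l) * l) / b * sqrt ((t - s) / l))))"
    if "u \<le> s" "s < t" "t \<le> u + l" "0 \<le> x" for s t x
    using assms that by (intro increment_tail') auto
  have "0 < sqrt ((u + l) * l) / b" using assms b_pos by auto
  note max = dyadic_maximal_inequality[OF * ** \<open>0 < l\<close> this \<open>ln 4 \<le> y\<close>]
  show "E \<in> sets M" unfolding E_def by (rule max(1))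
  show "prob E \<le> 2 * C * exp (- y)" unfolding E_def by (rule max(2))
qed

text \<open>With y = 2 m in the maximal inequality, the union over the 2^m intervals of level m has
  probability of order (2 exp (-2))^m, which is summable. The oscillation allowed is of order m sqrt
  (1/2)^m, which still tends to 0.\<close>

lemma AE_dyadic_oscillation:
  "AE \<omega> in M. \<forall>\<^sub>F m in sequentially. \<forall>j<2 ^ m. \<forall>n. \<forall>i\<le>2 ^ n.
    \<bar>X (real j / 2 ^ m + real i / 2 ^ n * (1 / 2 ^ m)) \<omega> - X (real j / 2 ^ m) \<omega>\<bar>
      \<le> 2 * real m * (sqrt (1/2) ^ m / b) * chaining_const"
proof -
  define E where "E m j = {\<omega> \<in> space M. \<exists>n. \<exists>i\<le>2 ^ n. 2 * real m *
      (sqrt ((real j / 2 ^ m + 1 / 2 ^ m) * (1 / 2 ^ m)) / b) * chaining_const <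
      \<bar>X (real j / 2 ^ m + real i / 2 ^ n * (1 / 2 ^ m)) \<omega> - X (real j / 2 ^ m) \<omega>\<bar>}" for m j :: nat
  have "ln 4 = 2 * ln (2 :: real)" using ln_realpow[of 2 2] by simp
  then have ln4: "ln 4 \<le> (2 :: real)" using ln_le_minus_one[of "2 :: real"] by simp
  have le1: "real j / 2 ^ m + 1 / 2 ^ m \<le> 1" if "j < 2 ^ m" for j m :: nat
  proof -
    have "real (j + 1) \<le> real (2 ^ m)" using that unfolding of_nat_le_iff by simp
    then show ?thesis by (simp add: field_simps)
  qed
  have E: "E m j \<in> sets M \<and> prob (E m j) \<le> 2 * C * exp (- (2 * real m))"
    if "j < 2 ^ m" "1 \<le> m" for m j
  proof -
    have "0 \<le> real j / 2 ^ m" "0 < 1 / (2 ^ m :: real)" "ln 4 \<le> 2 * real m"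
      using that ln4 by auto
    from dyadic_interval_maximal[OF this(1,2) le1[OF that(1)] this(3)] show ?thesis
      unfolding E_def by (intro conjI)
  qed
  \<comment> \<open>At m = 0 the choice y = 2 m violates \<open>ln 4 \<le> y\<close>; that level is
    left out.\<close>
  define A where "A m = (\<Union>j\<in>{..<2 ^ m}. if 1 \<le> m then E m j else {})" for m
  have Am: "A m \<in> sets M" for m
    unfolding A_def using E by (intro sets.finite_UN) auto
  have pA: "prob (A m) \<le> 2 * C * (2 * exp (- 2)) ^ m" for m
  proof -
    have "prob (A m) \<le> (\<Sum>j<2 ^ m. prob (if 1 \<le> m then E m j else {}))"
      unfolding A_def using E by (intro finite_measure_subadditive_finite) auto
    also have "\<dots> \<le> (\<Sum>j<(2::nat) ^ m. 2 * C * exp (- (2 * real m)))"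
      using E C_nonneg by (intro sum_mono) auto
    also have "\<dots> = 2 * C * (2 * exp (- 2)) ^ m"
      by (simp add: power_mult_distrib exp_of_nat_mult[symmetric] mult.commute)
    finally show ?thesis .
  qed
  have "summable (\<lambda>m. 2 * C * (2 * exp (- 2 :: real)) ^ m)"
  proof (intro summable_mult summable_geometric)
    show "norm (2 * exp (- 2 :: real)) < 1"
      using exp_ge_add_one_self[of "2::real"] by (simp add: exp_minus field_simps)
  qed
  then have "summable (\<lambda>m. prob (A m))"
    by (rule summable_comparison_test'[where N = 0]) (use pA in auto)
  then have "AE \<omega> in M. \<forall>\<^sub>F m in sequentially. \<omega> \<in> space M - A m"
    using Am by (intro borel_cantelli_AE1) (auto simp: emeasure_eq_measure)
  then show ?thesis
  proof (rule AE_mp, intro AE_I2 impI)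
    fix \<omega> assume "\<omega> \<in> space M" "\<forall>\<^sub>F m in sequentially. \<omega> \<in> space M - A m"
    from this(2) eventually_ge_at_top[of 1]
    show "\<forall>\<^sub>F m in sequentially. \<forall>j<2 ^ m. \<forall>n. \<forall>i\<le>2 ^ n.
      \<bar>X (real j / 2 ^ m + real i / 2 ^ n * (1 / 2 ^ m)) \<omega> - X (real j / 2 ^ m) \<omega>\<bar>
      \<le> 2 * real m * (sqrt (1/2) ^ m / b) * chaining_const"
    proof eventually_elim
      case (elim m)
      show ?case
      proof (intro allI impI)
        fix j n i :: nat assume j: "j < 2 ^ m" and i: "i \<le> 2 ^ n"
        have "sqrt ((real j / 2 ^ m + 1 / 2 ^ m) * (1 / 2 ^ m)) \<le> sqrt (1 * (1 / 2 ^ m))"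
          using le1[OF j] by (intro real_sqrt_le_mono mult_right_mono) auto
        also have "\<dots> = sqrt (1/2) ^ m" by (simp add: sqrt_half_power)
        finally have "2 * real m * (sqrt ((real j / 2 ^ m + 1 / 2 ^ m) * (1 / 2 ^ m)) / b) * chaining_const
            \<le> 2 * real m * (sqrt (1/2) ^ m / b) * chaining_const"
          using b_pos chaining_const_pos by (intro mult_right_mono mult_left_mono divide_right_mono) auto
        moreover have "\<omega> \<notin> E m j" using elim j by (auto simp: A_def)
        then have "\<bar>X (real j / 2 ^ m + real i / 2 ^ n * (1 / 2 ^ m)) \<omega> - X (real j / 2 ^ m) \<omega>\<bar>
            \<le> 2 * real m * (sqrt ((real j / 2 ^ m + 1 / 2 ^ m) * (1 / 2 ^ m)) / b) * chaining_const"
          using i \<open>\<omega> \<in> space M\<close> by (auto simp: E_def not_less)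
        ultimately show "\<bar>X (real j / 2 ^ m + real i / 2 ^ n * (1 / 2 ^ m)) \<omega> - X (real j / 2 ^ m) \<omega>\<bar>
            \<le> 2 * real m * (sqrt (1/2) ^ m / b) * chaining_const" by linarith
      qed
    qed
  qed
qed

theorem AE_continuous_lim_dyadic:
  "AE \<omega> in M. continuous_on {0..1} (\<lambda>t. lim (\<lambda>n. X (dyadic_floor n t) \<omega>))"
  using AE_dyadic_oscillation
proof (rule AE_mp, intro AE_I2 impI)
  fix \<omega>
  have "(\<lambda>m. 2 * real m * (sqrt (1/2) ^ m / b) * chaining_const) \<longlonglongrightarrow> 0"
  proof -
    have "(\<lambda>m. real m * sqrt (1/2) ^ m) \<longlonglongrightarrow> 0"
      using sqrt_half by (intro powser_times_n_limit_0) auto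
    then have "(\<lambda>m. real m * sqrt (1/2) ^ m * (2 / b * chaining_const)) \<longlonglongrightarrow> 0 * (2 / b * chaining_const)"
      by (intro tendsto_intros)
    then show ?thesis by (simp add: mult_ac)
  qed
  moreover assume "\<forall>\<^sub>F m in sequentially. \<forall>j<2 ^ m. \<forall>n. \<forall>i\<le>2 ^ n.
    \<bar>X (real j / 2 ^ m + real i / 2 ^ n * (1 / 2 ^ m)) \<omega> - X (real j / 2 ^ m) \<omega>\<bar>
      \<le> 2 * real m * (sqrt (1/2) ^ m / b) * chaining_const"
  ultimately show "continuous_on {0..1} (\<lambda>t. lim (\<lambda>n. X (dyadic_floor n t) \<omega>))"
    by (rule continuous_on_lim_dyadic_floor)
qed

text \<open>The oscillation bound says nothing about \<open>X t\<close> itself when t is not dyadic.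
  A separate Borel-Cantelli argument at each fixed t identifies the limit, which makes the limit
  process a version of \<open>X\<close>.\<close>

theorem AE_tendsto_dyadic:
  assumes t: "t \<in> {0..1}"
  shows "AE \<omega> in M. (\<lambda>n. X (dyadic_floor n t) \<omega>) \<longlonglongrightarrow> X t \<omega>"
proof -
  define r where "r n = 2 * real n * (sqrt (1/2) ^ n / b)" for n
  have r: "r \<longlonglongrightarrow> 0"
  proof -
    have "(\<lambda>m. real m * sqrt (1/2) ^ m) \<longlonglongrightarrow> 0"
      using sqrt_half by (intro powser_times_n_limit_0) auto
    then have "(\<lambda>m. real m * sqrt (1/2) ^ m * (2 / b)) \<longlonglongrightarrow> 0 * (2 / b)"
      by (intro tendsto_intros)
    then show ?thesis by (simp add: r_def[abs_def] mult_ac)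
  qed
  have d: "dyadic_floor n t \<in> {0..1}" for n
    using dyadic_floor_le[of n t] dyadic_floor_nonneg[of t n] t by auto
  define A where "A n = {\<omega> \<in> space M. r n < \<bar>X t \<omega> - X (dyadic_floor n t) \<omega>\<bar>}" for n
  have Am: "A n \<in> sets M" for n
  proof -
    have [measurable]: "X t \<in> borel_measurable M" "X (dyadic_floor n t) \<in> borel_measurable M"
      using t d by (auto intro: measurable_X)
    show ?thesis unfolding A_def by measurable
  qed
  have pA: "prob (A n) \<le> C * exp (- 2) ^ n" for n
  \<comment> \<open>The increment tail is available for distinct times only.\<close>
  proof (cases "dyadic_floor n t = t")
    case True
    have "0 \<le> r n" using b_pos sqrt_half by (simp add: r_def)
    then have "A n = {}" using True by (auto simp: A_def)
    then show ?thesis using C_nonneg by simp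
  next
    case False
    let ?d = "dyadic_floor n t"
    have lt: "?d < t" using dyadic_floor_le[of n t] False by simp
    have "prob (A n) \<le> C * exp (- (r n / (sqrt (1 * (1 / 2 ^ n)) / b * sqrt ((t - ?d) / (1 / 2 ^ n)))))"
      unfolding A_def
    proof (rule increment_tail')
      show "0 \<le> r n" using b_pos sqrt_half(1) unfolding r_def by (intro mult_nonneg_nonneg divide_nonneg_pos zero_le_power) auto
    qed (use t d[of n] lt in auto)
    also have "\<dots> \<le> C * exp (- (2 * real n))"
    proof (intro mult_left_mono C_nonneg, simp only: exp_le_cancel_iff neg_le_iff_le)
      have s: "sqrt (1 * (1 / 2 ^ n)) = sqrt (1/2) ^ n" by (simp add: sqrt_half_power)
      have "2 * real n = r n / (sqrt (1/2) ^ n / b * 1)"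
        using b_pos sqrt_half(1) by (simp add: r_def)
      also have "\<dots> \<le> r n / (sqrt (1/2) ^ n / b * sqrt ((t - ?d) / (1 / 2 ^ n)))"
        using b_pos sqrt_half(1) lt dyadic_floor_gt[of t n]
        by (intro divide_left_mono mult_left_mono) (auto simp: r_def field_simps)
      finally show "2 * real n \<le> r n / (sqrt (1 * (1 / 2 ^ n)) / b * sqrt ((t - ?d) / (1 / 2 ^ n)))"
        unfolding s .
    qed
    also have "exp (- (2 * real n)) = exp (- 2) ^ n"
      by (simp add: exp_of_nat_mult[symmetric] mult.commute)
    finally show ?thesis .
  qed
  have "summable (\<lambda>n. C * exp (- 2 :: real) ^ n)"
    by (intro summable_mult summable_geometric) auto
  then have "summable (\<lambda>n. prob (A n))"
    by (rule summable_comparison_test'[where N = 0]) (use pA in auto)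
  then have "AE \<omega> in M. \<forall>\<^sub>F n in sequentially. \<omega> \<in> space M - A n"
    using Am by (intro borel_cantelli_AE1) (auto simp: emeasure_eq_measure)
  then show ?thesis
  proof (rule AE_mp, intro AE_I2 impI)
    fix \<omega> assume "\<omega> \<in> space M" "\<forall>\<^sub>F n in sequentially. \<omega> \<in> space M - A n"
    then have "\<forall>\<^sub>F n in sequentially. norm (X (dyadic_floor n t) \<omega> - X t \<omega>) \<le> r n"
      by (auto simp: A_def not_less abs_minus_commute elim: eventually_mono)
    then have "(\<lambda>n. X (dyadic_floor n t) \<omega> - X t \<omega>) \<longlonglongrightarrow> 0"
      using r by (rule Lim_null_comparison)
    then show "(\<lambda>n. X (dyadic_floor n t) \<omega>) \<longlonglongrightarrow> X t \<omega>" by (simp add: LIM_zero_iff)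
  qed
qed

text \<open>Three losses are combined: a factor 1 + \<epsilon> at the points of the geometric
  sequence, an additional \<epsilon> for the oscillation up to the next larger point, and a factor 1
  + \<epsilon> for replacing ln (k + 1) by log log (1/t). Together they give (1 + 2 \<epsilon>) (1 +
  \<epsilon>).\<close>

lemma AE_eventually_loglog_bound:
  assumes cont: "AE \<omega> in M. continuous_on {0..1} (\<lambda>t. X t \<omega>)"
    and "0 < \<kappa>" "\<kappa> < \<kappa>'"
    and one_point: "\<And>\<eta>. 0 < \<eta> \<Longrightarrow> \<eta> < 1 \<Longrightarrow> \<exists>B. \<forall>\<^sub>F t in at_right 0. \<forall>x.
      prob {\<omega> \<in> space M. x < X t \<omega>} \<le> B * exp (- ((1 - \<eta>) * x / (\<kappa> * t)))"
  shows "AE \<omega> in M. \<forall>\<^sub>F t in at_right 0. X t \<omega> / (t * ln (ln (1 / t))) \<le> \<kappa>'"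
proof -
  \<comment> \<open>The 5 comes from (1 + 2 \<epsilon>) (1 + \<epsilon>) = 1 + 3 \<epsilon> + 2
    \<epsilon>^2, which is at most 1 + 5 \<epsilon> for \<epsilon> at most 1.\<close>
  define \<epsilon> where "\<epsilon> = min 1 ((\<kappa>' - \<kappa>) / (5 * \<kappa>))"
  have \<epsilon>: "0 < \<epsilon>" "\<epsilon> \<le> 1" using assms by (auto simp: \<epsilon>_def)
  have "\<epsilon> * \<epsilon> \<le> \<epsilon>" using \<epsilon> by (intro mult_left_le) auto
  then have "(1 + 2 * \<epsilon>) * (1 + \<epsilon>) \<le> 1 + 5 * \<epsilon>" by (simp add: algebra_simps)
  also have "\<epsilon> \<le> (\<kappa>' - \<kappa>) / (5 * \<kappa>)" by (simp add: \<epsilon>_def)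
  then have "1 + 5 * \<epsilon> \<le> 1 + 5 * ((\<kappa>' - \<kappa>) / (5 * \<kappa>))" by linarith
  also have "\<dots> = \<kappa>' / \<kappa>" using \<open>0 < \<kappa>\<close> by (simp add: field_simps)
  finally have \<epsilon>\<kappa>: "\<kappa> * ((1 + 2 * \<epsilon>) * (1 + \<epsilon>)) \<le> \<kappa>'" using \<open>0 < \<kappa>\<close> by (simp add: field_simps)

  \<comment> \<open>z is 1 - \<theta>. The square makes the oscillation factor at most \<epsilon>
    \<kappa> / 2, and z at most 1/2 ensures \<theta>^k / 2 \<le> \<theta>^(k+1), which absorbs the
    remaining factor 2.\<close>
  define z where "z = min (1/2) ((\<epsilon> * \<kappa> * b / (4 * chaining_const))\<^sup>2)"
  define \<theta> where "\<theta> = 1 - z"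
  have z: "0 < z" "z \<le> 1/2" using \<epsilon> \<open>0 < \<kappa>\<close> b_pos chaining_const_pos by (auto simp: z_def)
  have \<theta>: "1/2 \<le> \<theta>" "\<theta> < 1" "0 < \<theta>" using z by (auto simp: \<theta>_def)
  have "sqrt z \<le> sqrt ((\<epsilon> * \<kappa> * b / (4 * chaining_const))\<^sup>2)"
    by (intro real_sqrt_le_mono) (simp add: z_def)
  also have "\<dots> = \<epsilon> * \<kappa> * b / (4 * chaining_const)"
    using \<epsilon> \<open>0 < \<kappa>\<close> b_pos chaining_const_pos by simp
  finally have sqrt_z: "2 * (sqrt z / b) * chaining_const \<le> \<epsilon> * \<kappa> / 2"
    using b_pos chaining_const_pos by (simp add: field_simps)

  define \<tau> where "\<tau> k = \<theta> ^ k" for k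
  have \<tau>: "0 < \<tau> k" "\<tau> k \<le> 1" "\<tau> (Suc k) = \<theta> * \<tau> k" for k
    using \<theta> by (auto simp: \<tau>_def power_le_one)
  have len: "\<tau> (Suc k) + z * \<tau> k = \<tau> k" for k by (simp add: \<tau> \<theta>_def algebra_simps)
  \<comment> \<open>At t = \<open>\<tau> (Suc k)\<close>, log log (1/t) is asymptotic to log k, so
    \<open>h k\<close> stands for \<kappa> t log log (1/t). The + 1 makes the logarithm nonnegative
    at k = 0.\<close>
  define h where "h k = \<kappa> * \<tau> (Suc k) * ln (real k + 1)" for k

  define A where "A k = {\<omega> \<in> space M. (1 + \<epsilon>) * h k < X (\<tau> (Suc k)) \<omega>}" for k
  have Am: "A k \<in> sets M" for k
  proof -
    have [measurable]: "X (\<tau> (Suc k)) \<in> borel_measurable M"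
      using \<tau>[of "Suc k"] by (intro measurable_X) auto
    show ?thesis unfolding A_def by measurable
  qed
  have A: "AE \<omega> in M. \<forall>\<^sub>F k in sequentially. \<omega> \<in> space M - A k"
  proof (rule borel_cantelli_AE1)
    \<comment> \<open>Solves (1 - \<eta>) (1 + \<epsilon>) = 1 + \<epsilon> / 2: after the loss in
      the one-point tail the exponent of k + 1 still exceeds 1 in absolute value.\<close>
    define \<eta> where "\<eta> = \<epsilon> / (2 * (1 + \<epsilon>))"
    have \<eta>: "0 < \<eta>" "\<eta> < 1" "(1 - \<eta>) * (1 + \<epsilon>) = 1 + \<epsilon> / 2"
      using \<epsilon> by (auto simp: \<eta>_def field_simps)
    from one_point[OF \<eta>(1,2)] obtain B where B: "\<forall>\<^sub>F t in at_right 0. \<forall>x.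
        prob {\<omega> \<in> space M. x < X t \<omega>} \<le> B * exp (- ((1 - \<eta>) * x / (\<kappa> * t)))" by blast
    have "(\<lambda>k. \<tau> (Suc k)) \<longlonglongrightarrow> 0"
      unfolding \<tau>_def using \<theta> by (intro LIMSEQ_power_zero LIMSEQ_Suc) auto
    then have "filterlim (\<lambda>k. \<tau> (Suc k)) (at_right 0) sequentially"
      using \<tau>(1) by (intro tendsto_imp_filterlim_at_right always_eventually) auto
    from eventually_compose_filterlim[OF B this]
    have "\<forall>\<^sub>F k in sequentially. norm (prob (A k)) \<le> B * real (Suc k) powr - (1 + \<epsilon> / 2)"
    proof eventually_elim
      case (elim k)
      have "(1 - \<eta>) * ((1 + \<epsilon>) * h k) / (\<kappa> * \<tau> (Suc k)) = (1 - \<eta>) * (1 + \<epsilon>) * ln (real k + 1)"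
        using \<open>0 < \<kappa>\<close> \<tau>(1)[of "Suc k"] by (simp add: h_def)
      then have "(1 - \<eta>) * ((1 + \<epsilon>) * h k) / (\<kappa> * \<tau> (Suc k)) = (1 + \<epsilon> / 2) * ln (real (Suc k))"
        by (simp only: \<eta>) (simp add: add.commute)
      with elim[rule_format, of "(1 + \<epsilon>) * h k"] show ?case 
        by (simp add: A_def powr_def algebra_simps)
    qed
    moreover have "summable (\<lambda>k. B * real (Suc k) powr - (1 + \<epsilon> / 2))"
      using \<epsilon> by (intro summable_mult, subst summable_Suc_iff) (auto simp: summable_real_powr_iff)
    ultimately show "summable (\<lambda>k. prob (A k))" by (rule summable_comparison_test_ev)
  qed (auto simp: Am emeasure_eq_measure)

  \<comment> \<open>Here y = 2 ln (k + 1), which turns the maximal inequality into the summable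
    bound 2 C / (k + 1)^2. The condition \<open>ln 4 \<le> y\<close> amounts to k being at least
    1.\<close>
  define E where "E k = {\<omega> \<in> space M. \<exists>n. \<exists>i\<le>2 ^ n.
      2 * ln (real k + 1) * (sqrt ((\<tau> (Suc k) + z * \<tau> k) * (z * \<tau> k)) / b) * chaining_const <
      \<bar>X (\<tau> (Suc k) + real i / 2 ^ n * (z * \<tau> k)) \<omega> - X (\<tau> (Suc k)) \<omega>\<bar>}" for k
  have E: "E k \<in> sets M" "prob (E k) \<le> 2 * C * (1 / (real (Suc k))\<^sup>2)" if "1 \<le> k" for k
  proof -
    have "ln 2 \<le> ln (real k + 1)" using that by simp
    moreover have "ln 4 = 2 * ln (2 :: real)" using ln_realpow[of 2 2] by simp
    ultimately have y: "ln 4 \<le> 2 * ln (real k + 1)" by simp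
    have pos: "0 < z * \<tau> k" "0 \<le> \<tau> (Suc k)" "\<tau> (Suc k) + z * \<tau> k \<le> 1"
      using z \<tau>(1)[of k] \<tau>(1)[of "Suc k"] \<tau>(2)[of k] unfolding len by auto
    note max = dyadic_interval_maximal[OF pos(2,1,3) y]
    show "E k \<in> sets M" unfolding E_def by (rule max(1))
    have "prob (E k) \<le> 2 * C * exp (- (2 * ln (real k + 1)))" unfolding E_def by (rule max(2))
    also have "exp (- (2 * ln (real k + 1))) = 1 / (real (Suc k))\<^sup>2"
      by (simp add: exp_minus exp_double divide_inverse add.commute)
    finally show "prob (E k) \<le> 2 * C * (1 / (real (Suc k))\<^sup>2)" .
  qed
  have "AE \<omega> in M. \<forall>\<^sub>F k in sequentially. \<omega> \<in> space M - (if 1 \<le> k then E k else {})"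
  proof (rule borel_cantelli_AE1)
    have "summable (\<lambda>k. 2 * C * (1 / (real (Suc k))\<^sup>2))"
      using inverse_power_summable[of 2, where 'a = real]
      by (intro summable_mult, subst summable_Suc_iff) (simp add: divide_inverse)
    then show "summable (\<lambda>k. prob (if 1 \<le> k then E k else {}))"
      by (rule summable_comparison_test'[where N = 1]) (use E in auto)
  qed (use E in \<open>auto simp: emeasure_eq_measure\<close>)
  from cont A this show ?thesis
  proof eventually_elim
    case (elim \<omega>)
    \<comment> \<open>The argument k ln (1/\<theta>) is ln (1 / \<tau> k). The fixed factor ln
      (1/\<theta>) disappears from the ratio of logarithms in the limit.\<close>
    have loglog: "\<forall>\<^sub>F k in sequentially. 0 < ln (real k * ln (1 / \<theta>)) \<and>
        ln (real k + 1) \<le> (1 + \<epsilon>) * ln (real k * ln (1 / \<theta>))"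
    proof -
      define c where "c = ln (1 / \<theta>)"
      have "0 < c" using \<theta> by (simp add: c_def)
      have "(\<lambda>k. ln (real k + 1) / ln (real k * c)) \<longlonglongrightarrow> 1" using \<open>0 < c\<close> by real_asymp
      then have "\<forall>\<^sub>F k in sequentially. ln (real k + 1) / ln (real k * c) < 1 + \<epsilon>"
        using \<epsilon> by (intro order_tendstoD(2)) auto
      moreover have "\<forall>\<^sub>F k in sequentially. 0 < ln (real k * c)" using \<open>0 < c\<close> by real_asymp
      ultimately show ?thesis unfolding c_def[symmetric]
        by eventually_elim (auto simp: field_simps)
    qed
    from elim(2,3) loglog eventually_ge_at_top[of 1]
    have "\<forall>\<^sub>F k in sequentially. \<forall>t. \<tau> (Suc k) < t \<longrightarrow> t \<le> \<tau> k \<longrightarrow>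
        X t \<omega> / (t * ln (ln (1 / t))) \<le> \<kappa>'"
    proof eventually_elim
      case (elim k)
      show ?case
      proof (intro allI impI)
        fix t assume t: "\<tau> (Suc k) < t" "t \<le> \<tau> k"
        have t0: "0 < t" using t \<tau>(1)[of "Suc k"] by simp
        have ln0: "0 < ln (real k + 1)" using \<open>1 \<le> k\<close> by simp
        let ?r = "2 * ln (real k + 1) * (sqrt ((\<tau> (Suc k) + z * \<tau> k) * (z * \<tau> k)) / b) * chaining_const"
        \<comment> \<open>The factor t of the scale acts here: the result is of order \<tau> k and
          not of order sqrt (\<tau> k).\<close>
        have "sqrt ((\<tau> (Suc k) + z * \<tau> k) * (z * \<tau> k)) = \<tau> k * sqrt z"
          unfolding len using \<tau>(1)[of k] by (simp add: real_sqrt_mult)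
        then have "?r = 2 * (sqrt z / b) * chaining_const * (ln (real k + 1) * \<tau> k)" by simp
        also have "\<dots> \<le> \<epsilon> * \<kappa> / 2 * (ln (real k + 1) * \<tau> k)"
          using ln0 \<tau>(1)[of k] by (intro mult_right_mono sqrt_z) auto
        also have "\<dots> = \<epsilon> * \<kappa> * ln (real k + 1) * (1/2 * \<tau> k)" by simp
        also have "\<dots> \<le> \<epsilon> * \<kappa> * ln (real k + 1) * (\<theta> * \<tau> k)"
          using \<epsilon> \<open>0 < \<kappa>\<close> ln0 \<theta> \<tau>(1)[of k] by (intro mult_left_mono mult_right_mono) auto
        also have "\<dots> = \<epsilon> * h k" by (simp add: h_def \<tau>(3))
        finally have r: "?r \<le> \<epsilon> * h k" .
        have "\<bar>X t \<omega> - X (\<tau> (Suc k)) \<omega>\<bar> \<le> ?r"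
        proof (rule dyadic_bound_imp_bound[where f = "\<lambda>t. X t \<omega>"])
          show "continuous_on {\<tau> (Suc k)..\<tau> (Suc k) + z * \<tau> k} (\<lambda>t. X t \<omega>)"
            using \<open>continuous_on {0..1} (\<lambda>t. X t \<omega>)\<close>
            by (rule continuous_on_subset) (use \<tau>(1)[of "Suc k"] \<tau>(2)[of k] len[of k] in auto)
          show "t \<in> {\<tau> (Suc k)..\<tau> (Suc k) + z * \<tau> k}" using t unfolding len by simp
          show "0 < z * \<tau> k" using z \<tau>(1)[of k] by simp
          show "\<bar>X (\<tau> (Suc k) + real i / 2 ^ n * (z * \<tau> k)) \<omega> - X (\<tau> (Suc k)) \<omega>\<bar> \<le> ?r"
            if "i \<le> 2 ^ n" for n i
            using elim(2) \<open>1 \<le> k\<close> that unfolding E_def by (fastforce simp: not_less)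
        qed
        moreover have "X (\<tau> (Suc k)) \<omega> \<le> (1 + \<epsilon>) * h k"
          using elim(1) by (auto simp: A_def not_less)
        ultimately have "X t \<omega> \<le> (1 + \<epsilon>) * h k + \<epsilon> * h k" using r by linarith
        also have "\<dots> = \<kappa> * (1 + 2 * \<epsilon>) * ln (real k + 1) * \<tau> (Suc k)"
          by (simp add: h_def algebra_simps)
        also have "\<dots> \<le> \<kappa> * (1 + 2 * \<epsilon>) * ln (real k + 1) * t"
          using \<epsilon> \<open>0 < \<kappa>\<close> ln0 t by (intro mult_left_mono) auto
        also have "\<dots> \<le> \<kappa> * (1 + 2 * \<epsilon>) * ((1 + \<epsilon>) * ln (real k * ln (1 / \<theta>))) * t"
          using \<epsilon> \<open>0 < \<kappa>\<close> elim(3) t0 by (intro mult_left_mono mult_right_mono) auto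
        also have "\<dots> = \<kappa> * ((1 + 2 * \<epsilon>) * (1 + \<epsilon>)) * (ln (real k * ln (1 / \<theta>)) * t)" by simp
        also have "\<dots> \<le> \<kappa>' * (ln (real k * ln (1 / \<theta>)) * t)"
          using elim(3) t0 by (intro mult_right_mono \<epsilon>\<kappa>) auto
        finally have Xt: "X t \<omega> \<le> \<kappa>' * (ln (real k * ln (1 / \<theta>)) * t)" .
        have "real k * ln (1 / \<theta>) = ln (1 / \<tau> k)"
          using \<theta> by (simp add: \<tau>_def ln_div ln_realpow)
        also have "\<dots> \<le> ln (1 / t)" using t t0 \<tau>(1)[of k]
          by (subst ln_le_cancel_iff) (auto simp: field_simps)
        finally have "real k * ln (1 / \<theta>) \<le> ln (1 / t)" .
        moreover have "0 < real k * ln (1 / \<theta>)" using \<theta> \<open>1 \<le> k\<close> by simp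
        ultimately have loglog_t: "ln (real k * ln (1 / \<theta>)) \<le> ln (ln (1 / t))" by simp
        have "\<kappa>' * (ln (real k * ln (1 / \<theta>)) * t) \<le> \<kappa>' * (ln (ln (1 / t)) * t)"
          using loglog_t t0 assms by (intro mult_left_mono mult_right_mono) auto
        with Xt have "X t \<omega> \<le> \<kappa>' * (ln (ln (1 / t)) * t)" by linarith
        moreover have "0 < ln (ln (1 / t))" using loglog_t elim(3) by linarith
        ultimately show "X t \<omega> / (t * ln (ln (1 / t))) \<le> \<kappa>'"
          using t0 by (simp add: pos_divide_le_eq mult.commute)
      qed
    qed
    then obtain K where K: "\<And>k t. K \<le> k \<Longrightarrow> \<tau> (Suc k) < t \<Longrightarrow> t \<le> \<tau> k \<Longrightarrow>
        X t \<omega> / (t * ln (ln (1 / t))) \<le> \<kappa>'" unfolding eventually_sequentially by blast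
    have "\<forall>\<^sub>F t in at_right 0. t \<in> {0<..<\<tau> K}"
      using \<tau>(1) by (intro eventually_at_right_real)
    then show ?case
    proof eventually_elim
      case (elim t)
      then have "0 < t" "t \<le> 1" using \<tau>(2)[of K] by auto
      then obtain k where k: "\<theta> ^ Suc k < t" "t \<le> \<theta> ^ k"
        using geometric_scale_exists[OF \<theta>(3,2)] by blast
      have "\<theta> ^ Suc k < \<theta> ^ K" using k elim by (simp add: \<tau>_def)
      then have "K < Suc k" using \<theta> by (meson not_less power_decreasing less_imp_le)
      then show ?case using K[of k t] k by (simp add: \<tau>_def)
    qed
  qed
qed

theorem AE_Limsup_loglog:
  assumes cont: "AE \<omega> in M. continuous_on {0..1} (\<lambda>t. X t \<omega>)"
    and "0 < \<kappa>" "0 < \<rho>"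
    and one_point: "\<And>\<eta> \<kappa>'. 0 < \<eta> \<Longrightarrow> \<eta> < 1 \<Longrightarrow> \<rho> * \<kappa> < \<kappa>' \<Longrightarrow> \<exists>B. \<forall>\<^sub>F t in at_right 0. \<forall>x.
      prob {\<omega> \<in> space M. x < X t \<omega>} \<le> B * exp (- ((1 - \<eta>) * x / (\<kappa>' * t)))"
  shows "AE \<omega> in M. Limsup (at_right 0) (\<lambda>t. ereal (X t \<omega> / (\<rho> * t * ln (ln (1 / t))))) \<le> \<kappa>"
proof -
  \<comment> \<open>Countably many constants keep the exceptional sets null. The value with 1 / (2
    (n + 1)) lies strictly between the limit constant and the bound, as the one-point hypothesis and
    the previous lemma both demand a strict inequality.\<close>
  have "AE \<omega> in M. \<forall>\<^sub>F t in at_right 0. X t \<omega> / (t * ln (ln (1 / t))) \<le> \<rho> * (\<kappa> + 1 / real (Suc n))" for n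
    using \<open>0 < \<kappa>\<close> \<open>0 < \<rho>\<close>
    by (intro AE_eventually_loglog_bound[where \<kappa> = "\<rho> * (\<kappa> + 1 / (2 * real (Suc n)))"] cont one_point
        mult_strict_left_mono mult_pos_pos)
      (auto intro!: add_pos_pos divide_strict_left_mono)
  then have "AE \<omega> in M. \<forall>n. \<forall>\<^sub>F t in at_right 0.
      X t \<omega> / (t * ln (ln (1 / t))) \<le> \<rho> * (\<kappa> + 1 / real (Suc n))"
    by (intro AE_all_countable[THEN iffD2] allI)
  then show ?thesis
  proof eventually_elim
    case (elim \<omega>)
    have le: "Limsup (at_right 0) (\<lambda>t. ereal (X t \<omega> / (\<rho> * t * ln (ln (1 / t))))) \<le> ereal (\<kappa> + 1 / real (Suc n))"
      for n
    proof (rule Limsup_bounded, rule eventually_mono[OF elim[rule_format, of n]])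
      fix t assume "X t \<omega> / (t * ln (ln (1 / t))) \<le> \<rho> * (\<kappa> + 1 / real (Suc n))"
      then have "X t \<omega> / (t * ln (ln (1 / t))) / \<rho> \<le> \<rho> * (\<kappa> + 1 / real (Suc n)) / \<rho>"
        using \<open>0 < \<rho>\<close> by (intro divide_right_mono) auto
      then show "ereal (X t \<omega> / (\<rho> * t * ln (ln (1 / t)))) \<le> ereal (\<kappa> + 1 / real (Suc n))"
        using \<open>0 < \<rho>\<close> by (simp add: mult_ac)
    qed
    have "(\<lambda>n. \<kappa> + 1 / real (Suc n)) \<longlonglongrightarrow> \<kappa> + 0"
      by (intro tendsto_intros LIMSEQ_inverse_real_of_nat[unfolded inverse_eq_divide])
    then have "(\<lambda>n. ereal (\<kappa> + 1 / real (Suc n))) \<longlonglongrightarrow> ereal \<kappa>" by simp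
    then show ?case by (rule LIMSEQ_le_const) (use le in auto)
  qed
qed

end

text \<open>Each Laplace transform involves finitely many times, so the exceptional sets unite to a
  null set. Measurability and nonnegativity at every point do not follow from almost sure equality
  and are therefore assumed.\<close>

lemma permanental_process_version:
  assumes perm: "permanental_process N \<alpha> K I X" and version: "version_of N I Y X"
    and "\<And>t. t \<in> I \<Longrightarrow> Y t \<in> borel_measurable N"
    and "\<And>t \<omega>. t \<in> I \<Longrightarrow> \<omega> \<in> space N \<Longrightarrow> 0 \<le> Y t \<omega>"
  shows "permanental_process N \<alpha> K I Y"
proof -
  have "(\<integral>\<omega>. exp (- (\<Sum>i<n. s i * Y (t i) \<omega>)) \<partial>N) = (\<integral>\<omega>. exp (- (\<Sum>i<n. s i * X (t i) \<omega>)) \<partial>N)"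
    if t: "\<forall>i<n. t i \<in> I \<and> 0 < s i" for n and t s :: "nat \<Rightarrow> real"
  proof (rule integral_cong_AE)
    have [measurable]: "X (t i) \<in> borel_measurable N" "Y (t i) \<in> borel_measurable N" if "i < n" for i
      using t that assms by (auto simp: permanental_process_def)
    have "AE \<omega> in N. \<forall>i\<in>{..<n}. Y (t i) \<omega> = X (t i) \<omega>"
      using t version by (intro AE_finite_allI) (auto simp: version_of_def)
    then show "AE \<omega> in N. exp (- (\<Sum>i<n. s i * Y (t i) \<omega>)) = exp (- (\<Sum>i<n. s i * X (t i) \<omega>))"
      by eventually_elim simp
    show "(\<lambda>\<omega>. exp (- (\<Sum>i<n. s i * Y (t i) \<omega>))) \<in> borel_measurable N" by measurable
    show "(\<lambda>\<omega>. exp (- (\<Sum>i<n. s i * X (t i) \<omega>))) \<in> borel_measurable N" by measurable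
  qed
  then show ?thesis using assms by (simp add: permanental_process_def)
qed

lemma permanental_sqrt_increment_tail:
  fixes K :: "real \<Rightarrow> real \<Rightarrow> real"
  assumes perm: "permanental_process N \<alpha> K {0..1} X" and "0 < \<alpha>" "0 < L"
    and K0: "\<And>t. t \<in> {0..1} \<Longrightarrow> 0 \<le> K t t"
    and diff: "\<And>s t. 0 \<le> s \<Longrightarrow> s < t \<Longrightarrow> t \<le> 1 \<Longrightarrow> \<bar>K t t - K s s\<bar> \<le> L * (t - s)"
    and det0: "\<And>s t. 0 \<le> s \<Longrightarrow> s < t \<Longrightarrow> t \<le> 1 \<Longrightarrow> 0 \<le> K s s * K t t - K s t * K t s"
    and det: "\<And>s t. 0 \<le> s \<Longrightarrow> s < t \<Longrightarrow> t \<le> 1 \<Longrightarrow> K s s * K t t - K s t * K t s \<le> L\<^sup>2 * (t * (t - s))"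
  shows "sqrt_increment_tail N X (2 * 2 powr \<alpha>) (1 / (4 * L))"
proof -
  from perm interpret prob_space N by (simp add: permanental_process_def)
  show ?thesis
  proof
    show "X t \<in> borel_measurable N" if "t \<in> {0..1}" for t
      using perm that by (simp add: permanental_process_def)
    show "0 < 1 / (4 * L)" using \<open>0 < L\<close> by simp
    fix s t x :: real assume st: "0 \<le> s" "s < t" "t \<le> 1" and "0 \<le> x"
    \<comment> \<open>The determinant condition then holds with 1/16. The diagonal condition holds
      with 1/4 because t - s \<le> sqrt (t (t - s)); it dictates the 4.\<close>
    define a where "a = 1 / (4 * L) / sqrt (t * (t - s))"
    have pos: "0 < t * (t - s)" using st by simp
    then have "0 < a" using \<open>0 < L\<close> by (simp add: a_def)
    have "(t - s) * (t - s) \<le> t * (t - s)" using st by (intro mult_right_mono) auto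
    then have "sqrt ((t - s)\<^sup>2) \<le> sqrt (t * (t - s))"
      by (intro real_sqrt_le_mono) (simp add: power2_eq_square)
    then have le: "t - s \<le> sqrt (t * (t - s))" using st by simp
    have "a * \<bar>K t t - K s s\<bar> \<le> a * (L * (t - s))"
      using \<open>0 < a\<close> diff[OF st] by (intro mult_left_mono) auto
    also have "\<dots> = 1/4 * ((t - s) / sqrt (t * (t - s)))" using \<open>0 < L\<close> by (simp add: a_def)
    also have "\<dots> \<le> 1/4 * 1" using le pos by (intro mult_left_mono) auto
    finally have 1: "a * \<bar>K t t - K s s\<bar> \<le> 1/4" by simp
    have "a\<^sup>2 * (K s s * K t t - K s t * K t s) \<le> a\<^sup>2 * (L\<^sup>2 * (t * (t - s)))"
      using det[OF st] by (intro mult_left_mono) auto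
    also have "\<dots> = 1/16"
      using pos \<open>0 < L\<close> st by (simp add: a_def power_divide power_mult_distrib)
    finally have 2: "a\<^sup>2 * (K s s * K t t - K s t * K t s) \<le> 1/4" by simp
    have "measure N {\<omega> \<in> space N. x < \<bar>X t \<omega> - X s \<omega>\<bar>} \<le> 2 * 2 powr \<alpha> * exp (- (a * x))"
      using st K0 det0[OF st] 1 2 \<open>0 < a\<close> \<open>0 < \<alpha>\<close>
      by (intro permanental_increment_tail[OF perm]) auto
    then show "measure N {\<omega> \<in> space N. x < \<bar>X t \<omega> - X s \<omega>\<bar>} \<le>
        2 * 2 powr \<alpha> * exp (- (1 / (4 * L) * x / sqrt (t * (t - s))))"
      by (simp add: a_def)
  qed
qed

section \<open>The kernel of the killed diffusion\<close>

lemma C2_lipschitz: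
  assumes "C2 f"
  obtains L where "0 \<le> L" "\<And>s t. s \<in> {0..1} \<Longrightarrow> t \<in> {0..1} \<Longrightarrow> \<bar>f t - f s\<bar> \<le> L * \<bar>t - s\<bar>"
proof -
  have d: "(f has_real_derivative deriv f x) (at x)" for x
    using assms by (auto simp: C2_def differentiable_on_def DERIV_deriv_iff_real_differentiable)
  have "continuous_on {0..1} (deriv f)"
    using assms by (auto simp: C2_def intro: differentiable_imp_continuous_on differentiable_on_subset)
  then have "bounded (deriv f ` {0..1})"
    by (intro compact_imp_bounded compact_continuous_image) auto
  then obtain L where L: "0 < L" "\<And>x. x \<in> {0..1} \<Longrightarrow> \<bar>deriv f x\<bar> \<le> L"
    by (auto simp: bounded_pos)
  have "norm (f t - f s) \<le> L * norm (t - s)" if "s \<in> {0..1}" "t \<in> {0..1}" for s t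
    using that L by (intro field_differentiable_bound[of "{0..1}" f "deriv f"])
      (auto intro: DERIV_subset[OF d])
  then show ?thesis using that[of L] L by auto
qed

locale killed_kernel =
  fixes p q :: "real \<Rightarrow> real" and \<mu> :: "real measure"
  assumes C2_p: "C2 p" and C2_q: "C2 q"
    and p_pos: "\<And>x. 0 < p x" and q_pos: "\<And>x. 0 < q x"
    and p_mono: "strict_mono p" and q_antimono: "strict_antimono_on UNIV q"
    and sets_\<mu>: "sets \<mu> = sets (restrict_space borel {0<..})"
    and finite_\<mu>: "finite_measure \<mu>"
begin

definition \<phi> :: "real \<Rightarrow> real" where "\<phi> x = p x - p 0 * q x / q 0"

definition J :: real where "J = (\<integral>x. q x \<partial>\<mu>)"

abbreviation V :: "real \<Rightarrow> real \<Rightarrow> real" where "V \<equiv> v_kernel p q"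
abbreviation F :: "real \<Rightarrow> real" where "F \<equiv> potential_fun V \<mu>"
abbreviation K :: "real \<Rightarrow> real \<Rightarrow> real" where "K x y \<equiv> V x y + F y"

sublocale finite_measure \<mu> by (rule finite_\<mu>)

lemma space_\<mu>: "space \<mu> = {0<..}"
  using sets_eq_imp_space_eq[OF sets_\<mu>] by (simp add: space_restrict_space)

lemma q_le: "x \<le> y \<Longrightarrow> q y \<le> q x"
  using q_antimono by (cases "x = y") (auto simp: monotone_on_def less_imp_le)

lemma \<phi>_0: "\<phi> 0 = 0"
  using q_pos[of 0] by (simp add: \<phi>_def)

lemma \<phi>_mono: "x \<le> y \<Longrightarrow> \<phi> x \<le> \<phi> y"
  unfolding \<phi>_def using p_mono p_pos[of 0] q_pos[of 0] q_le
  by (intro diff_mono divide_right_mono mult_left_mono) (auto simp: strict_mono_less_eq)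

lemma \<phi>_nonneg: "0 \<le> x \<Longrightarrow> 0 \<le> \<phi> x"
  using \<phi>_mono[of 0 x] \<phi>_0 by simp

text \<open>For nonnegative arguments the subtracted term is (p 0 / q 0) q x q y, so q at the larger
  argument factors out.\<close>

lemma V_eq: "0 \<le> x \<Longrightarrow> 0 \<le> y \<Longrightarrow> V x y = \<phi> (min x y) * q (max x y)"
  using p_pos[of 0] q_pos[of 0]
  by (auto simp: v_kernel_def u_kernel_def \<phi>_def field_simps min_def max_def)

lemma C2_measurable: "C2 f \<Longrightarrow> f \<in> borel_measurable borel"
  by (auto simp: C2_def intro: borel_measurable_continuous_onI differentiable_imp_continuous_on)

lemma borel_measurable_\<mu>:
  fixes f :: "real \<Rightarrow> real"
  shows "f \<in> borel_measurable borel \<Longrightarrow> f \<in> borel_measurable \<mu>"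
  using measurable_cong_sets[OF sets_\<mu> refl] measurable_restrict_space1 by blast

lemma q_integrable: "integrable \<mu> q"
  using q_le q_pos space_\<mu> borel_measurable_\<mu>[OF C2_measurable[OF C2_q]]
  by (intro integrable_const_bound[where B = "q 0"] AE_I2) (auto simp: less_imp_le)

lemma J_nonneg: "0 \<le> J"
  unfolding J_def using q_pos by (intro Bochner_Integration.integral_nonneg) (auto intro: less_imp_le)

lemma V_integrable: "0 \<le> y \<Longrightarrow> integrable \<mu> (\<lambda>x. V x y)"
proof (rule integrable_const_bound[where B = "\<phi> y * q 0"])
  assume "0 \<le> y"
  then show "AE x in \<mu>. norm (V x y) \<le> \<phi> y * q 0"
    using space_\<mu> \<phi>_nonneg \<phi>_mono q_le q_pos
    by (intro AE_I2) (auto simp: V_eq abs_mult less_imp_le intro!: mult_mono)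
  have [measurable]: "p \<in> borel_measurable borel" "q \<in> borel_measurable borel"
    using C2_measurable C2_p C2_q by auto
  show "(\<lambda>x. V x y) \<in> borel_measurable \<mu>"
    unfolding v_kernel_def u_kernel_def by (intro borel_measurable_\<mu>) measurable
qed

lemma V_nonneg: "0 \<le> x \<Longrightarrow> 0 \<le> y \<Longrightarrow> 0 \<le> V x y"
  using \<phi>_nonneg q_pos by (simp add: V_eq less_imp_le)

lemma F_nonneg: "0 \<le> y \<Longrightarrow> 0 \<le> F y"
  unfolding potential_fun_def using space_\<mu> V_nonneg
  by (intro integral_nonneg_AE AE_I2) auto

text \<open>Keeps the factor \<phi> y that vanishes at 0 and integrates the other one. For x \<ge> y
  the estimate of \<open>V x y\<close> by \<phi> y q x is an equality.\<close>

lemma F_le: "0 \<le> y \<Longrightarrow> F y \<le> \<phi> y * J"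
proof -
  assume y: "0 \<le> y"
  have "F y \<le> (\<integral>x. \<phi> y * q x \<partial>\<mu>)"
    unfolding potential_fun_def
  proof (rule integral_mono)
    fix x assume "x \<in> space \<mu>"
    then show "V x y \<le> \<phi> y * q x"
      using y space_\<mu> \<phi>_nonneg \<phi>_mono q_le q_pos
      by (auto simp: V_eq less_imp_le intro!: mult_mono)
  qed (use V_integrable[OF y] q_integrable in auto)
  then show ?thesis by (simp add: J_def)
qed

lemma K_diag_le: "0 \<le> t \<Longrightarrow> K t t \<le> \<phi> t * (q 0 + J)"
  using F_le[of t] q_le[of 0 t] \<phi>_nonneg[of t]
  by (auto simp: V_eq distrib_left intro!: add_mono mult_left_mono)

lemma K_nonneg: "0 \<le> s \<Longrightarrow> 0 \<le> t \<Longrightarrow> 0 \<le> K s t"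
  using V_nonneg F_nonneg by simp

text \<open>Turns the Lipschitz bound on the diagonal into K t t = O(t), the source of the factor t
  in the determinant bound.\<close>

lemma K_0: "K 0 0 = 0"
  using K_diag_le[of 0] K_nonneg[of 0 0] \<phi>_0 by simp

lemma \<phi>_q_lipschitz:
  obtains L where "0 < L"
    "\<And>s t. 0 \<le> s \<Longrightarrow> s \<le> t \<Longrightarrow> t \<le> 1 \<Longrightarrow> \<phi> t - \<phi> s \<le> L * (t - s)"
    "\<And>s t. 0 \<le> s \<Longrightarrow> s \<le> t \<Longrightarrow> t \<le> 1 \<Longrightarrow> q s - q t \<le> L * (t - s)"
proof -
  obtain Lp where Lp: "0 \<le> Lp" "\<And>s t. s \<in> {0..1} \<Longrightarrow> t \<in> {0..1} \<Longrightarrow> \<bar>p t - p s\<bar> \<le> Lp * \<bar>t - s\<bar>"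
    using C2_lipschitz[OF C2_p] by blast
  obtain Lq where Lq: "0 \<le> Lq" "\<And>s t. s \<in> {0..1} \<Longrightarrow> t \<in> {0..1} \<Longrightarrow> \<bar>q t - q s\<bar> \<le> Lq * \<bar>t - s\<bar>"
    using C2_lipschitz[OF C2_q] by blast
  define L where "L = Lp + (p 0 / q 0 + 1) * Lq + 1"
  have c: "0 < p 0 / q 0" using p_pos q_pos by simp
  show ?thesis
  proof (rule that)
    have "0 \<le> (p 0 / q 0 + 1) * Lq" using c Lq by (intro mult_nonneg_nonneg) auto
    then show "0 < L" using Lp by (simp add: L_def)
    fix s t :: real assume st: "0 \<le> s" "s \<le> t" "t \<le> 1"
    have p: "p t - p s \<le> Lp * (t - s)" using Lp(2)[of s t] st by auto
    have q: "q s - q t \<le> Lq * (t - s)" using Lq(2)[of s t] st by auto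
    have n: "0 \<le> Lp * (t - s)" "0 \<le> Lq * (t - s)"
      using Lp(1) Lq(1) st by auto
    have n': "0 \<le> p 0 / q 0 * (Lq * (t - s))"
      using mult_nonneg_nonneg[OF less_imp_le[OF c] n(2)] .
    have L: "L * (t - s) = Lp * (t - s) + p 0 / q 0 * (Lq * (t - s)) + Lq * (t - s) + (t - s)"
      by (simp only: L_def distrib_right) (simp add: mult.assoc)
    show "q s - q t \<le> L * (t - s)" using q n n' st unfolding L by linarith
    have "\<phi> x = p x - p 0 / q 0 * q x" for x by (simp add: \<phi>_def)
    then have "\<phi> t - \<phi> s = (p t - p s) + p 0 / q 0 * (q s - q t)"
      by (simp only: right_diff_distrib)
    also have "\<dots> \<le> Lp * (t - s) + p 0 / q 0 * (Lq * (t - s))"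
      using p q c by (intro add_mono mult_left_mono) auto
    finally show "\<phi> t - \<phi> s \<le> L * (t - s)" using n st unfolding L by linarith
  qed
qed

text \<open>The increment is a difference of two nonnegative terms, one for each factor. The
  constant does not depend on x, so the bound can be integrated over \<mu>.\<close>

lemma V_increment:
  assumes "0 < x" "0 \<le> s" "s \<le> t" "t \<le> 1" "0 \<le> L"
    and L\<phi>: "\<And>s t. 0 \<le> s \<Longrightarrow> s \<le> t \<Longrightarrow> t \<le> 1 \<Longrightarrow> \<phi> t - \<phi> s \<le> L * (t - s)"
    and Lq: "\<And>s t. 0 \<le> s \<Longrightarrow> s \<le> t \<Longrightarrow> t \<le> 1 \<Longrightarrow> q s - q t \<le> L * (t - s)"
  shows "\<bar>V x t - V x s\<bar> \<le> L * (q 0 + \<phi> 1) * (t - s)"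
proof -
  let ?a = "min x s" and ?b = "min x t" and ?c = "max x s" and ?d = "max x t"
  have "\<phi> ?b - \<phi> ?a \<le> L * (?b - ?a)" using assms by (intro L\<phi>) auto
  also have "\<dots> \<le> L * (t - s)" using assms by (intro mult_left_mono) auto
  finally have \<phi>: "\<phi> ?b - \<phi> ?a \<le> L * (t - s)" "0 \<le> \<phi> ?b - \<phi> ?a"
    using assms by (auto intro!: \<phi>_mono)
  have "q ?c - q ?d \<le> L * (t - s)"
  \<comment> \<open>Beyond t both maxima equal x and the difference is 0, so the Lipschitz bound for
    q is used within [0, 1] only.\<close>
  proof (cases "x \<le> t")
    case True
    then have "q ?c - q ?d \<le> L * (?d - ?c)" using assms by (intro Lq) auto
    also have "\<dots> \<le> L * (t - s)" using assms by (intro mult_left_mono) auto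
    finally show ?thesis .
  qed (use assms in auto)
  moreover have "0 \<le> q ?c - q ?d" using assms by (auto intro!: q_le)
  ultimately have q: "q ?c - q ?d \<le> L * (t - s)" "0 \<le> q ?c - q ?d" .
  have "V x t - V x s = (\<phi> ?b - \<phi> ?a) * q ?d - \<phi> ?a * (q ?c - q ?d)"
    using assms by (simp add: V_eq algebra_simps)
  moreover have "(\<phi> ?b - \<phi> ?a) * q ?d \<le> L * (t - s) * q 0"
    using \<phi> q_le[of 0 ?d] q_pos[of ?d] assms by (intro mult_mono) auto
  moreover have "0 \<le> (\<phi> ?b - \<phi> ?a) * q ?d" using \<phi> q_pos[of ?d] by simp
  moreover have "\<phi> ?a * (q ?c - q ?d) \<le> \<phi> 1 * (L * (t - s))"
    using q \<phi>_mono[of ?a 1] \<phi>_nonneg[of 1] assms by (intro mult_mono) auto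
  moreover have "0 \<le> \<phi> ?a * (q ?c - q ?d)" using q \<phi>_nonneg[of ?a] assms by simp
  moreover have "0 \<le> L * (t - s) * q 0" "0 \<le> \<phi> 1 * (L * (t - s))"
    using assms q_pos[of 0] \<phi>_nonneg[of 1] by auto
  moreover have "L * (q 0 + \<phi> 1) * (t - s) = L * (t - s) * q 0 + \<phi> 1 * (L * (t - s))"
    by (simp add: algebra_simps)
  ultimately show ?thesis by linarith
qed

text \<open>The determinant is K s s (K t t - K s t) + K s t (K s s - K t s). The potential cancels
  in both differences, which are nonnegative and O(t - s), while the other factors are O(t).\<close>

lemma K_bounds:
  obtains L where "0 < L"
    "\<And>s t. 0 \<le> s \<Longrightarrow> s \<le> t \<Longrightarrow> t \<le> 1 \<Longrightarrow> \<bar>K t t - K s s\<bar> \<le> L * (t - s)"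
    "\<And>s t. 0 \<le> s \<Longrightarrow> s \<le> t \<Longrightarrow> t \<le> 1 \<Longrightarrow> 0 \<le> K s s * K t t - K s t * K t s"
    "\<And>s t. 0 \<le> s \<Longrightarrow> s \<le> t \<Longrightarrow> t \<le> 1 \<Longrightarrow> K s s * K t t - K s t * K t s \<le> L\<^sup>2 * (t * (t - s))"
proof -
  obtain L0 where L0: "0 < L0"
    and L\<phi>: "\<And>s t. 0 \<le> s \<Longrightarrow> s \<le> t \<Longrightarrow> t \<le> 1 \<Longrightarrow> \<phi> t - \<phi> s \<le> L0 * (t - s)"
    and Lq: "\<And>s t. 0 \<le> s \<Longrightarrow> s \<le> t \<Longrightarrow> t \<le> 1 \<Longrightarrow> q s - q t \<le> L0 * (t - s)"
    using \<phi>_q_lipschitz by blast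
  define L1 where "L1 = L0 * (q 0 + \<phi> 1)"
  have c: "0 < q 0" "0 \<le> \<phi> 1" using q_pos \<phi>_nonneg by auto
  have L1: "0 < L1" unfolding L1_def using c L0 by (intro mult_pos_pos) auto
  \<comment> \<open>\<open>L1\<close> accounts for V and \<open>L1\<close> times the mass of \<mu>
    for the potential.\<close>
  define L2 where "L2 = L1 + L1 * measure \<mu> (space \<mu>)"
  have L2: "L1 \<le> L2" "0 < L2" unfolding L2_def using L1 by (auto intro!: add_pos_nonneg)
  have F: "\<bar>F t - F s\<bar> \<le> L1 * (t - s) * measure \<mu> (space \<mu>)" if "0 \<le> s" "s \<le> t" "t \<le> 1" for s t
  proof -
    have int: "integrable \<mu> (\<lambda>x. V x t)" "integrable \<mu> (\<lambda>x. V x s)"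
      using that by (auto intro: V_integrable)
    have "\<bar>F t - F s\<bar> = \<bar>\<integral>x. V x t - V x s \<partial>\<mu>\<bar>"
      using int by (simp add: potential_fun_def)
    also have "\<dots> \<le> (\<integral>x. \<bar>V x t - V x s\<bar> \<partial>\<mu>)" by (rule integral_abs_bound)
    also have "\<dots> \<le> (\<integral>x. L1 * (t - s) \<partial>\<mu>)"
    proof (rule integral_mono)
      fix x assume "x \<in> space \<mu>"
      then have "0 < x" by (simp add: space_\<mu>)
      from V_increment[OF this that less_imp_le[OF L0] L\<phi> Lq]
      show "\<bar>V x t - V x s\<bar> \<le> L1 * (t - s)" unfolding L1_def .
    qed (use int in auto)
    finally show ?thesis by (simp add: mult_ac)
  qed
  have Vq: "0 \<le> q t * (\<phi> t - \<phi> s)" "q t * (\<phi> t - \<phi> s) \<le> L1 * (t - s)"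
    "0 \<le> \<phi> s * (q s - q t)" "\<phi> s * (q s - q t) \<le> L1 * (t - s)"
    if st: "0 \<le> s" "s \<le> t" "t \<le> 1" for s t
  proof -
    show "0 \<le> q t * (\<phi> t - \<phi> s)" "0 \<le> \<phi> s * (q s - q t)"
      using q_pos[of t] \<phi>_nonneg[of s] \<phi>_mono[of s t] q_le[of s t] st by auto
    have n: "0 \<le> L0 * (t - s)" using L0 st by simp
    have "q t * (\<phi> t - \<phi> s) \<le> q 0 * (L0 * (t - s))"
      using q_pos[of t] q_le[of 0 t] L\<phi>[OF st] \<phi>_mono[of s t] c st by (intro mult_mono) auto
    moreover have "\<phi> s * (q s - q t) \<le> \<phi> 1 * (L0 * (t - s))"
      using \<phi>_nonneg[of s] \<phi>_mono[of s 1] Lq[OF st] q_le[of s t] c st by (intro mult_mono) auto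
    moreover have "0 \<le> q 0 * (L0 * (t - s))" "0 \<le> \<phi> 1 * (L0 * (t - s))"
      using n c by auto
    moreover have "L1 * (t - s) = q 0 * (L0 * (t - s)) + \<phi> 1 * (L0 * (t - s))"
      by (simp add: L1_def algebra_simps)
    ultimately show "q t * (\<phi> t - \<phi> s) \<le> L1 * (t - s)" "\<phi> s * (q s - q t) \<le> L1 * (t - s)"
      by linarith+
  qed
  have diag: "\<bar>K t t - K s s\<bar> \<le> L2 * (t - s)" if st: "0 \<le> s" "s \<le> t" "t \<le> 1" for s t
  proof -
    have "V t t - V s s = q t * (\<phi> t - \<phi> s) - \<phi> s * (q s - q t)"
      using st by (simp add: V_eq algebra_simps)
    then have "\<bar>V t t - V s s\<bar> \<le> L1 * (t - s)" using Vq[OF st] by linarith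
    moreover have "L2 * (t - s) = L1 * (t - s) + L1 * (t - s) * measure \<mu> (space \<mu>)"
      by (simp add: L2_def algebra_simps)
    ultimately show ?thesis using F[OF st] by linarith
  qed
  have det: "0 \<le> K s s * K t t - K s t * K t s \<and>
      K s s * K t t - K s t * K t s \<le> (2 * L2)\<^sup>2 * (t * (t - s))"
    if st: "0 \<le> s" "s \<le> t" "t \<le> 1" for s t
  proof -
    let ?d = "q t * (\<phi> t - \<phi> s)" and ?e = "\<phi> s * (q s - q t)"
    have d: "K t t - K s t = ?d" "K s s - K t s = ?e"
      using st by (auto simp: V_eq min_absorb2 max_absorb1 algebra_simps)
    have "K s s * K t t - K s t * K t s = K s s * (K t t - K s t) + K s t * (K s s - K t s)"
      by (simp add: algebra_simps)
    then have eq: "K s s * K t t - K s t * K t s = K s s * ?d + K s t * ?e" unfolding d .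
    have Ktt: "K t t \<le> L2 * t" using diag[of 0 t] K_0 st by auto
    \<comment> \<open>Off the diagonal the bound is inherited from K t t, which exceeds K s t by the
      nonnegative \<open>?d\<close>.\<close>
    have Kst: "K s t \<le> L2 * t" using d(1) Vq(1)[OF st] Ktt by linarith
    have "K s s \<le> L2 * s" using diag[of 0 s] K_0 st by auto
    also have "\<dots> \<le> L2 * t" using L2 st by simp
    finally have Kss: "K s s \<le> L2 * t" .
    have "K s s * ?d + K s t * ?e \<le> L2 * t * (L1 * (t - s)) + L2 * t * (L1 * (t - s))"
      using st L2
      by (intro add_mono mult_mono[OF Kss Vq(2)[OF st] _ Vq(1)[OF st]]
          mult_mono[OF Kst Vq(4)[OF st] _ Vq(3)[OF st]]) auto
    also have "\<dots> = 2 * (L2 * t * (t - s)) * L1" by (simp add: algebra_simps)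
    also have "\<dots> \<le> 2 * (L2 * t * (t - s)) * L2"
      using L2 st by (intro mult_left_mono) auto
    also have "\<dots> \<le> (2 * L2)\<^sup>2 * (t * (t - s))"
      using L2 st by (simp add: power2_eq_square mult.assoc)
    finally show ?thesis
      using Vq[OF st] K_nonneg[of s s] K_nonneg[of s t] st unfolding eq by auto
  qed
  show ?thesis
  \<comment> \<open>The two terms of the determinant give 2 \<open>L2\<close>^2; doubling
    \<open>L2\<close> lets one constant serve in the linear and in the squared bound.\<close>
  proof (rule that[of "2 * L2"])
    show "\<bar>K t t - K s s\<bar> \<le> 2 * L2 * (t - s)" if st: "0 \<le> s" "s \<le> t" "t \<le> 1" for s t
    proof -
      have "0 \<le> L2 * (t - s)" using L2 st by simp
      then show ?thesis using diag[OF st] by linarith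
    qed
  qed (use det L2 in auto)
qed

section \<open>The slope of the kernel at 0 and the conclusion\<close>

definition wronskian :: real where
  "wronskian = deriv p 0 * q 0 - deriv q 0 * p 0"

lemma \<phi>_quotient: "((\<lambda>t. \<phi> t / t) \<longlongrightarrow> wronskian / q 0) (at_right 0)"
proof -
  have d: "(f has_real_derivative deriv f 0) (at 0)" if "C2 f" for f
    using that by (auto simp: C2_def differentiable_on_def DERIV_deriv_iff_real_differentiable)
  have "(\<phi> has_real_derivative deriv p 0 - p 0 * deriv q 0 / q 0) (at 0)"
    unfolding \<phi>_def using q_pos[of 0] by (auto intro!: derivative_eq_intros d C2_p C2_q)
  also have "deriv p 0 - p 0 * deriv q 0 / q 0 = wronskian / q 0"
    using q_pos[of 0] by (simp add: wronskian_def field_simps)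
  finally have "((\<lambda>t. \<phi> t / t) \<longlongrightarrow> wronskian / q 0) (at 0)"
    by (simp add: DERIV_def \<phi>_0)
  then show ?thesis by (rule tendsto_mono[OF at_le, rotated]) simp
qed

text \<open>Strict monotonicity of p and q alone allows both derivatives to vanish at 0, so the
  inequality is weak and the value 0 becomes a separate case below.\<close>

lemma wronskian_nonneg: "0 \<le> wronskian"
proof -
  have "0 \<le> wronskian / q 0"
  proof (rule tendsto_lowerbound[OF \<phi>_quotient])
    show "\<forall>\<^sub>F t in at_right 0. 0 \<le> \<phi> t / t"
      using \<phi>_nonneg by (auto simp: eventually_at_filter)
  qed simp
  then show ?thesis using q_pos[of 0] by (simp add: zero_le_divide_iff)
qed

lemma eventually_K_diag_le:
  assumes "wronskian * (1 + J / q 0) < \<kappa>"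
  shows "\<forall>\<^sub>F t in at_right 0. K t t \<le> \<kappa> * t"
proof -
  have "((\<lambda>t. \<phi> t / t * (q 0 + J)) \<longlongrightarrow> wronskian / q 0 * (q 0 + J)) (at_right 0)"
    by (intro tendsto_intros \<phi>_quotient)
  moreover have "wronskian / q 0 * (q 0 + J) < \<kappa>"
    using assms q_pos[of 0] by (simp add: field_simps)
  ultimately have "\<forall>\<^sub>F t in at_right 0. \<phi> t / t * (q 0 + J) < \<kappa>" by (rule order_tendstoD)
  moreover have "\<forall>\<^sub>F t in at_right (0::real). 0 < t" by (simp add: eventually_at_filter)
  ultimately show ?thesis
  proof eventually_elim
    case (elim t)
    then have "\<phi> t * (q 0 + J) < \<kappa> * t" by (simp add: field_simps)
    then show ?case using K_diag_le[of t] elim by simp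
  qed
qed

theorem continuous_version_Limsup:
  assumes perm: "permanental_process N \<alpha> K {0..1} X" and "0 < \<alpha>"
  shows "\<exists>Y. permanental_process N \<alpha> K {0..1} Y \<and> version_of N {0..1} Y X \<and>
    (AE \<omega> in N. continuous_on {0..1} (\<lambda>t. Y t \<omega>)) \<and>
    (AE \<omega> in N. Limsup (at_right 0) (\<lambda>t. ereal (Y t \<omega> / (wronskian * t * ln (ln (1 / t)))))
      \<le> ereal (1 + J / q 0))"
proof -
  obtain L where L: "0 < L"
    "\<And>s t. 0 \<le> s \<Longrightarrow> s \<le> t \<Longrightarrow> t \<le> 1 \<Longrightarrow> \<bar>K t t - K s s\<bar> \<le> L * (t - s)"
    "\<And>s t. 0 \<le> s \<Longrightarrow> s \<le> t \<Longrightarrow> t \<le> 1 \<Longrightarrow> 0 \<le> K s s * K t t - K s t * K t s"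
    "\<And>s t. 0 \<le> s \<Longrightarrow> s \<le> t \<Longrightarrow> t \<le> 1 \<Longrightarrow> K s s * K t t - K s t * K t s \<le> L\<^sup>2 * (t * (t - s))"
    using K_bounds by blast
  have tail: "sqrt_increment_tail N Z (2 * 2 powr \<alpha>) (1 / (4 * L))"
    if "permanental_process N \<alpha> K {0..1} Z" for Z
    using L(2-4) K_nonneg by (intro permanental_sqrt_increment_tail[OF that \<open>0 < \<alpha>\<close> L(1)]) auto
  interpret X: sqrt_increment_tail N X "2 * 2 powr \<alpha>" "1 / (4 * L)" by (rule tail[OF perm])
  \<comment> \<open>\<open>lim\<close> is unspecified where the sequence diverges. The maximum
    restores nonnegativity at every point, preserves continuity, and changes nothing where the limit
    equals the nonnegative \<open>X t \<omega>\<close>.\<close>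
  define Y where "Y t \<omega> = max 0 (lim (\<lambda>n. X (dyadic_floor n t) \<omega>))" for t \<omega>
  have floor: "dyadic_floor n t \<in> {0..1}" if "t \<in> {0..1}" for n t
    using that dyadic_floor_le[of n t] dyadic_floor_nonneg[of t n] by auto
  have Y_meas: "Y t \<in> borel_measurable N" if "t \<in> {0..1}" for t
  proof -
    have [measurable]: "X (dyadic_floor n t) \<in> borel_measurable N" for n
      using floor[OF that] by (rule X.measurable_X)
    show ?thesis unfolding Y_def by measurable
  qed
  have version: "version_of N {0..1} Y X"
    unfolding version_of_def
  proof
    fix t :: real assume t: "t \<in> {0..1}"
    have "\<omega> \<in> space N \<Longrightarrow> 0 \<le> X t \<omega>" for \<omega> using perm t by (simp add: permanental_process_def)
    then have "AE \<omega> in N. 0 \<le> X t \<omega>" by (rule AE_I2)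
    with X.AE_tendsto_dyadic[OF t] show "AE \<omega> in N. Y t \<omega> = X t \<omega>"
      by eventually_elim (simp add: Y_def limI)
  qed
  have permY: "permanental_process N \<alpha> K {0..1} Y"
    by (rule permanental_process_version[OF perm version Y_meas]) (auto simp: Y_def)
  \<comment> \<open>The tails depend on the kernel only. They were needed for \<open>X\<close> to
    construct \<open>Y\<close>, and now for \<open>Y\<close>, whose paths are continuous.\<close>
  interpret Y: sqrt_increment_tail N Y "2 * 2 powr \<alpha>" "1 / (4 * L)" by (rule tail[OF permY])
  have cont: "AE \<omega> in N. continuous_on {0..1} (\<lambda>t. Y t \<omega>)"
    using X.AE_continuous_lim_dyadic
    by eventually_elim (auto simp: Y_def intro!: continuous_intros)
  have pos: "0 < 1 + J / q 0" using J_nonneg q_pos[of 0] by (simp add: add_pos_nonneg)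
  have "AE \<omega> in N. Limsup (at_right 0) (\<lambda>t. ereal (Y t \<omega> / (wronskian * t * ln (ln (1 / t)))))
      \<le> ereal (1 + J / q 0)"
  proof (cases "wronskian = 0")
    case True
    \<comment> \<open>Division by zero gives 0, so the quotient is identically 0.\<close>
    then show ?thesis using pos by (intro AE_I2 Limsup_bounded) auto
  next
    case False
    then have w: "0 < wronskian" using wronskian_nonneg by simp
    show ?thesis
    proof (rule Y.AE_Limsup_loglog[OF cont pos w])
      fix \<eta> \<kappa> :: real assume \<eta>: "0 < \<eta>" "\<eta> < 1" and \<kappa>: "wronskian * (1 + J / q 0) < \<kappa>"
      have "0 < wronskian * (1 + J / q 0)" using w pos by simp
      then have "0 < \<kappa>" using \<kappa> by simp
      have "\<forall>\<^sub>F t in at_right (0::real). t \<in> {0<..<1}" by (intro eventually_at_right_real) simp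
      with eventually_K_diag_le[OF \<kappa>]
      have "\<forall>\<^sub>F t in at_right 0. \<forall>x. measure N {\<omega> \<in> space N. x < Y t \<omega>} \<le>
          \<eta> powr - \<alpha> * exp (- ((1 - \<eta>) * x / (\<kappa> * t)))"
      proof eventually_elim
        case (elim t)
        \<comment> \<open>With b = (1 - \<eta>) / (\<kappa> t) the margin from the pole is \<eta>
          for all small t, so the prefactor \<eta> powr -\<alpha> is uniform.\<close>
        have "(1 - \<eta>) / (\<kappa> * t) * K t t \<le> (1 - \<eta>) / (\<kappa> * t) * (\<kappa> * t)"
          using elim \<eta> \<open>0 < \<kappa>\<close> by (intro mult_left_mono) auto
        also have "\<dots> = 1 - \<eta>" using elim \<open>0 < \<kappa>\<close> by simp
        finally have "(1 - \<eta>) / (\<kappa> * t) * K t t \<le> 1 - \<eta>" .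
        then show ?case
          using permanental_tail[OF permY, of t "(1 - \<eta>) / (\<kappa> * t)" \<eta>] elim \<eta> \<open>0 < \<kappa>\<close> \<open>0 < \<alpha>\<close>
            K_nonneg[of t t] by simp
      qed
      then show "\<exists>B. \<forall>\<^sub>F t in at_right 0. \<forall>x. measure N {\<omega> \<in> space N. x < Y t \<omega>} \<le>
          B * exp (- ((1 - \<eta>) * x / (\<kappa> * t)))" by blast
    qed
  qed
  with permY version cont show ?thesis by blast
qed

end

theorem theorem1p7:
  fixes M :: "'w measure" and P :: "real \<Rightarrow> 'w measure" and Z :: "real \<Rightarrow> 'w \<Rightarrow> real option"
    and m \<mu> :: "real measure" and a c p q :: "real \<Rightarrow> real" and \<alpha> \<beta> :: real
    and N :: "'b measure" and X :: "real \<Rightarrow> 'b \<Rightarrow> real"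
  assumes "diffusion M P Z"
    and "regular_without_traps P Z"
    and "sets m = sets borel" and "sigma_finite_measure m" and "absolutely_continuous lborel m"
    and "symmetric_wrt P Z m"
    and "continuous_on UNIV (\<lambda>x. (a x)\<^sup>2)" and "continuous_on UNIV c" and "\<And>x. a x \<noteq> 0"
    and "has_generator P Z (diffusion_operator a c)"
    and "\<beta> > 0"
    and "C2 p" and "C2 q" and "\<And>x. p x > 0" and "\<And>x. q x > 0"
    and "strict_mono p" and "strict_antimono_on UNIV q"
    and "potential_density (exp_killed_law \<beta> P) (killed_process Z) m (u_kernel p q)"
    and "sets \<mu> = sets (restrict_space borel {0<..})" and "finite_measure \<mu>"
    and "\<alpha> > 0"
    and "permanental_process N \<alpha>
           (\<lambda>x y. v_kernel p q x y + potential_fun (v_kernel p q) \<mu> y) {0..1} X"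
  shows "\<exists>Y. permanental_process N \<alpha>
                (\<lambda>x y. v_kernel p q x y + potential_fun (v_kernel p q) \<mu> y) {0..1} Y \<and>
           version_of N {0..1} Y X \<and>
           (\<exists>\<delta>. 0 < \<delta> \<and> \<delta> \<le> 1 \<and> (AE \<omega> in N. continuous_on {0..\<delta>} (\<lambda>t. Y t \<omega>))) \<and>
           (AE \<omega> in N.
              Limsup (at_right 0)
                (\<lambda>t. ereal (Y t \<omega> / ((deriv p 0 * q 0 - deriv q 0 * p 0) * t * ln (ln (1 / t)))))
              \<le> ereal (1 + (\<integral>y. q y / q 0 \<partial>\<mu>)))"
proof -
  interpret killed_kernel p q \<mu>
    using assms by (simp add: killed_kernel_def)
  have J: "(\<integral>y. q y / q 0 \<partial>\<mu>) = J / q 0" by (simp add: J_def)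
  obtain Y where Y: "permanental_process N \<alpha> K {0..1} Y" "version_of N {0..1} Y X"
    "AE \<omega> in N. continuous_on {0..1} (\<lambda>t. Y t \<omega>)"
    "AE \<omega> in N. Limsup (at_right 0) (\<lambda>t. ereal (Y t \<omega> / (wronskian * t * ln (ln (1 / t)))))
      \<le> ereal (1 + J / q 0)"
    using continuous_version_Limsup[OF assms(22,21)] by blast
  \<comment> \<open>Continuity holds on all of [0, 1], so \<delta> = 1 is a witness.\<close>
  have "\<exists>\<delta>::real. 0 < \<delta> \<and> \<delta> \<le> 1 \<and> (AE \<omega> in N. continuous_on {0..\<delta>} (\<lambda>t. Y t \<omega>))"
    using Y(3) by (intro exI[of _ 1]) auto
  with Y show ?thesis
    unfolding J wronskian_def by (intro exI[of _ Y] conjI)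
qed

end
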